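(* If the $K$-vector spaces $A_\delta$ (the $\Delta$-graded components of $A$) are of finite dimension for all $\delta\in\Delta$, then the homogeneous subduction algorithm terminates for $A$; that is, it terminates after finitely many steps for every $\Delta$-homogeneous $f\in A$ and every set $\mathcal G\subseteq A$ of $\Delta$-homogeneous elements.
   Context: $K$ is a field; $A\le B$ are finitely generated commutative $K$-algebras and domains ($A$ a $K$-subalgebra of $B$). $(\Gamma,+,\succeq)$ is a linearly ordered abelian group (total order with $\gamma_1\succeq\gamma_2\Rightarrow\gamma_1+\gamma_3\succeq\gamma_2+\gamma_3$). $v:B\setminus\{0\}\to\Gamma$ is a valuation over $K$: $v(f+g)\succeq\min\{v(f),v(g)\}$ whenever $f,g,f+g\ne0$; $v(fg)=v(f)+v(g)$ for $f,g\neq 0$; $v(\lambda f)=v(f)$ for $0\ne\lambda\in K$, $f\neq0$. For $\gamma\in\Gamma$ let $F_{v\succeq\gamma}=\{f\in B\setminus\{0\}\mid v(f)\succeq\gamma\}\cup\{0\}$, similarly $F_{v\succ\gamma}$, and $\operatorname{gr}_v(B)=\bigoplus_{\gamma\in\Gamma}F_{v\succeq\gamma}/F_{v\succ\gamma}$ (associated graded algebra). For $0\ne f\in B$ with $v(f)=\gamma$, $\operatorname{in}_v(f)$ is the class of $f$ in $F_{v\succeq\gamma}/F_{v\succ\gamma}$. $A=\bigoplus_{\delta\in\Delta}A_\delta$ is graded by a finitely generated abelian group $\Delta$, with degree function $\deg_\Delta$. For $\Delta$-homogeneous $0\neq f\in A$ of degree $\delta$ put $\operatorname{in}_v^\Delta(f)=\operatorname{in}_v(f)\otimes\delta\in\operatorname{gr}_v(B)\otimes_KK\Delta$,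 where $K\Delta$ is the group ring. For $S\subseteq A$, $\operatorname{in}_v^\Delta(S)\le\operatorname{gr}_v(B)\otimes_KK\Delta$ is the $K$-subalgebra generated by all $\operatorname{in}_v^\Delta(f)$ with $0\ne f\in S$ $\Delta$-homogeneous. For a polynomial $h$, $\operatorname{Supp}(h)$ is the set of its non-zero terms. Homogeneous subduction algorithm. Input: a $\Delta$-homogeneous $f\in A$ and a (possibly infinite) set $\mathcal G\subseteq A$ of (non-zero) $\Delta$-homogeneous elements. Polynomials live in $K[X_g\mid g\in\mathcal G]$. Initialize $\mathcal G'=\emptyset$, $h=0$, $r=f$. While $r\neq0$ and $\operatorname{in}_v^\Delta(r)\in\operatorname{in}_v^\Delta(\mathcal G)$: choose a finite subset $\{f_1,\dots,f_k\}\subseteq\mathcal G$ and a polynomial $h'\in K[X_{f_1},\dots,X_{f_k}]$ with $h'(\operatorname{in}_v^\Delta(f_1),\dots,\operatorname{in}_v^\Delta(f_k))=\operatorname{in}_v^\Delta(r)$ and with $v(t(f_1,\dots,f_k))\succeq v(r)$ and $\deg_\Delta(t(f_1,\dots,f_k))=\deg_\Delta(r)$ for every $t\in\operatorname{Supp}(h')$ (such a choice always exists; it is made by an arbitrary rule); then replace $\mathcal G'$ by $\mathcal G'\cup\{f_1,\dots,f_k\}$, $r$ by $r-h'(f_1,\dots,f_k)$, and $h$ by $h+h'$. When the loop ends, return $\mathcal G'$, $h$, $r$. *)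

theory Defs
  imports
    "HOL-Algebra.QuotRing"
    "HOL-Algebra.Subrings"
    "HOL-Algebra.Module"
    "HOL-Library.Poly_Mapping"
    "HOL-Library.Set_Algebras"
    "HOL-Computational_Algebra.Group_Closure"
begin

text \<open>
  The field \<open>K\<close>, the domain \<open>B\<close>, the ordered value group \<open>\<Gamma>\<close> and the grading group \<open>\<Delta>\<close> are
  the types \<open>'k\<close>, \<open>'b\<close>, \<open>'g\<close> and \<open>'d\<close>, with their type class operations; \<open>A\<close> is a subset of \<open>'b\<close>.
  The associated graded algebra and its tensor product with the group ring depend on the valuation,
  hence are not types; they are algebra structures with an explicit carrier.
  Scalars always range over the whole type \<open>'k\<close>.
\<close>

section \<open>Algebras over a field\<close>

locale field_algebra = vector_space scale
  for scale :: "'k::field \<Rightarrow> 'b::comm_ring_1 \<Rightarrow> 'b" +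
  assumes scale_mult_left: "scale c x * y = scale c (x * y)"

definition type_algebra :: "('k \<Rightarrow> 'b \<Rightarrow> 'b::comm_ring_1) \<Rightarrow> ('k, 'b) module" where
  "type_algebra scale =
    \<lparr>carrier = UNIV, mult = (*), one = 1, zero = 0, add = (+), smult = scale\<rparr>"

definition is_K_subalgebra :: "('k, 'a, 'm) module_scheme \<Rightarrow> 'a set \<Rightarrow> bool" where
  "is_K_subalgebra R H \<longleftrightarrow> subring H R \<and> (\<forall>c. \<forall>x\<in>H. c \<odot>\<^bsub>R\<^esub> x \<in> H)"

definition generated_subalgebra :: "('k, 'a, 'm) module_scheme \<Rightarrow> 'a set \<Rightarrow> 'a set" where
  "generated_subalgebra R S = \<Inter> {H. is_K_subalgebra R H \<and> S \<subseteq> H}"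

text \<open>For a \<open>K\<close>-subalgebra \<open>H\<close> of \<open>R\<close>: finite generation as a \<open>K\<close>-algebra.\<close>

definition fin_gen_subalgebra :: "('k, 'a, 'm) module_scheme \<Rightarrow> 'a set \<Rightarrow> bool" where
  "fin_gen_subalgebra R H \<longleftrightarrow>
    is_K_subalgebra R H \<and> (\<exists>S. finite S \<and> S \<subseteq> carrier R \<and> H = generated_subalgebra R S)"

definition pm_scale :: "'k \<Rightarrow> ('a \<Rightarrow>\<^sub>0 'k) \<Rightarrow> ('a \<Rightarrow>\<^sub>0 'k::field)" where
  "pm_scale c p = Poly_Mapping.map ((*) c) p"

lemma lookup_pm_scale: "Poly_Mapping.lookup (pm_scale c p) k = c * Poly_Mapping.lookup p k"
  by (simp add: pm_scale_def Poly_Mapping.map.rep_eq when_def)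

lemma vector_space_pm_scale: "vector_space pm_scale"
  by unfold_locales (auto intro!: poly_mapping_eqI simp: lookup_pm_scale lookup_add algebra_simps)

text \<open>The convolution product on finitely supported functions makes \<open>'d \<Rightarrow>\<^sub>0 'k\<close> the group ring
  \<open>K\<Delta>\<close>; the group element \<open>\<delta>\<close> is \<^term>\<open>Poly_Mapping.single \<delta> 1\<close>.\<close>

definition group_algebra :: "('k::field, 'd::ab_group_add \<Rightarrow>\<^sub>0 'k) module" where
  "group_algebra = type_algebra pm_scale"

section \<open>Polynomials\<close>

text \<open>A polynomial in indeterminates \<open>X\<^sub>i\<close>, \<open>i :: 'i\<close>, maps exponent vectors to coefficients.\<close>

type_synonym ('i, 'k) polynomial = "('i \<Rightarrow>\<^sub>0 nat) \<Rightarrow>\<^sub>0 'k"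

definition indets :: "('i, 'k::zero) polynomial \<Rightarrow> 'i set" where
  "indets h = (\<Union>m\<in>Poly_Mapping.keys h. Poly_Mapping.keys m)"

definition Supp :: "('i, 'k::zero) polynomial \<Rightarrow> ('i, 'k) polynomial set" where
  "Supp h = {Poly_Mapping.single m (Poly_Mapping.lookup h m) | m. m \<in> Poly_Mapping.keys h}"

definition eval_poly ::
    "('k::zero, 'a, 'm) module_scheme \<Rightarrow> ('i \<Rightarrow> 'a) \<Rightarrow> ('i, 'k) polynomial \<Rightarrow> 'a" where
  "eval_poly R \<phi> h =
    (\<Oplus>\<^bsub>R\<^esub>m\<in>Poly_Mapping.keys h. Poly_Mapping.lookup h m \<odot>\<^bsub>R\<^esub>
      (\<Otimes>\<^bsub>R\<^esub>i\<in>Poly_Mapping.keys m. \<phi> i [^]\<^bsub>R\<^esub> Poly_Mapping.lookup m i))"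

section \<open>Tensor product of two algebras\<close>

text \<open>The free vector space on \<open>carrier R \<times> carrier S\<close>, with the product extending
  \<open>(a, b) (c, d) = (a c, b d)\<close> bilinearly, is divided by the subspace that makes
  \<open>(a, b) \<mapsto> a \<otimes> b\<close> bilinear.\<close>

definition tensor_free ::
    "('k::field, 'a, 'm) module_scheme \<Rightarrow> ('k, 'c, 'n) module_scheme \<Rightarrow> ('a \<times> 'c \<Rightarrow>\<^sub>0 'k) ring"
  where
  "tensor_free R S =
    \<lparr>carrier = {p. Poly_Mapping.keys p \<subseteq> carrier R \<times> carrier S},
     mult = (\<lambda>p q. \<Sum>(a, b)\<in>Poly_Mapping.keys p. \<Sum>(c, d)\<in>Poly_Mapping.keys q.
       Poly_Mapping.single (a \<otimes>\<^bsub>R\<^esub> c, b \<otimes>\<^bsub>S\<^esub> d)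
         (Poly_Mapping.lookup p (a, b) * Poly_Mapping.lookup q (c, d))),
     one = Poly_Mapping.single (\<one>\<^bsub>R\<^esub>, \<one>\<^bsub>S\<^esub>) 1,
     zero = 0,
     add = (+)\<rparr>"

definition tensor_relations ::
    "('k::field, 'a, 'm) module_scheme \<Rightarrow> ('k, 'c, 'n) module_scheme \<Rightarrow> ('a \<times> 'c \<Rightarrow>\<^sub>0 'k) set"
  where
  "tensor_relations R S = module.span pm_scale
    ({Poly_Mapping.single (a \<oplus>\<^bsub>R\<^esub> a', b) 1 - Poly_Mapping.single (a, b) 1 - Poly_Mapping.single (a', b) 1
        | a a' b. a \<in> carrier R \<and> a' \<in> carrier R \<and> b \<in> carrier S} \<union>
     {Poly_Mapping.single (a, b \<oplus>\<^bsub>S\<^esub> b') 1 - Poly_Mapping.single (a, b) 1 - Poly_Mapping.single (a, b') 1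
        | a b b'. a \<in> carrier R \<and> b \<in> carrier S \<and> b' \<in> carrier S} \<union>
     {Poly_Mapping.single (c \<odot>\<^bsub>R\<^esub> a, b) 1 - Poly_Mapping.single (a, b) c
        | c a b. a \<in> carrier R \<and> b \<in> carrier S} \<union>
     {Poly_Mapping.single (a, c \<odot>\<^bsub>S\<^esub> b) 1 - Poly_Mapping.single (a, b) c
        | c a b. a \<in> carrier R \<and> b \<in> carrier S})"

definition tensor_algebra ::
    "('k::field, 'a, 'm) module_scheme \<Rightarrow> ('k, 'c, 'n) module_scheme \<Rightarrow>
     ('k, ('a \<times> 'c \<Rightarrow>\<^sub>0 'k) set) module" where
  "tensor_algebra R S =
    (let F = tensor_free R S; I = tensor_relations R S; Q = F Quot I in
      \<lparr>carrier = carrier Q, mult = mult Q, one = one Q, zero = zero Q, add = add Q,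
       smult = (\<lambda>c X. \<Union>p\<in>X. I +>\<^bsub>F\<^esub> pm_scale c p)\<rparr>)"

definition pure_tensor ::
    "('k::field, 'a, 'm) module_scheme \<Rightarrow> ('k, 'c, 'n) module_scheme \<Rightarrow>
     'a \<Rightarrow> 'c \<Rightarrow> ('a \<times> 'c \<Rightarrow>\<^sub>0 'k) set" where
  "pure_tensor R S a b = tensor_relations R S +>\<^bsub>tensor_free R S\<^esub> Poly_Mapping.single (a, b) 1"

section \<open>Valuations and the associated graded algebra\<close>

text \<open>The value of \<open>v\<close> at \<open>0\<close> is irrelevant.\<close>

locale field_valuation =
  fixes scale :: "'k::field \<Rightarrow> 'b::idom \<Rightarrow> 'b"
    and v :: "'b \<Rightarrow> 'g::linordered_ab_group_add"
  assumes v_add: "\<lbrakk>f \<noteq> 0; g \<noteq> 0; f + g \<noteq> 0\<rbrakk> \<Longrightarrow> v (f + g) \<ge> min (v f) (v g)"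
    and v_mult: "\<lbrakk>f \<noteq> 0; g \<noteq> 0\<rbrakk> \<Longrightarrow> v (f * g) = v f + v g"
    and v_scale: "\<lbrakk>c \<noteq> 0; f \<noteq> 0\<rbrakk> \<Longrightarrow> v (scale c f) = v f"

definition F_ge :: "('b::zero \<Rightarrow> 'g::linorder) \<Rightarrow> 'g \<Rightarrow> 'b set" where
  "F_ge v \<gamma> = {f. f \<noteq> 0 \<and> v f \<ge> \<gamma>} \<union> {0}"

definition F_gt :: "('b::zero \<Rightarrow> 'g::linorder) \<Rightarrow> 'g \<Rightarrow> 'b set" where
  "F_gt v \<gamma> = {f. f \<noteq> 0 \<and> v f > \<gamma>} \<union> {0}"

definition gr_component :: "('b::comm_ring_1 \<Rightarrow> 'g::linorder) \<Rightarrow> 'g \<Rightarrow> 'b set set" where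
  "gr_component v \<gamma> = {f +o F_gt v \<gamma> | f. f \<in> F_ge v \<gamma>}"

definition initial_form :: "('b::comm_ring_1 \<Rightarrow> 'g::linorder) \<Rightarrow> 'b \<Rightarrow> 'g \<Rightarrow> 'b set" where
  "initial_form v f = (\<lambda>\<gamma>. if \<gamma> = v f then f +o F_gt v \<gamma> else F_gt v \<gamma>)"

text \<open>An element of the direct sum is the family of its components, which are cosets;
  sums and products of sets are elementwise. The product of the cosets of \<open>f\<close> and \<open>g\<close> in degrees
  \<open>\<alpha>\<close> and \<open>\<beta>\<close> is the coset of \<open>f g\<close> in degree \<open>\<alpha> + \<beta>\<close>; the elementwise product is only contained
  in that coset, and adding \<open>F_gt v (\<alpha> + \<beta>)\<close> completes it.\<close>

definition gr_algebra ::
    "('k \<Rightarrow> 'b \<Rightarrow> 'b) \<Rightarrow> ('b::comm_ring_1 \<Rightarrow> 'g::linordered_ab_group_add) \<Rightarrow> ('k, 'g \<Rightarrow> 'b set) module"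
  where
  "gr_algebra scale v =
    \<lparr>carrier = {x. (\<forall>\<gamma>. x \<gamma> \<in> gr_component v \<gamma>) \<and> finite {\<gamma>. x \<gamma> \<noteq> F_gt v \<gamma>}},
     mult = (\<lambda>x y \<gamma>. (\<Sum>\<alpha>\<in>{\<alpha>. x \<alpha> \<noteq> F_gt v \<alpha>}. x \<alpha> * y (\<gamma> - \<alpha>)) + F_gt v \<gamma>),
     one = (\<lambda>\<gamma>. if \<gamma> = 0 then 1 +o F_gt v \<gamma> else F_gt v \<gamma>),
     zero = F_gt v,
     add = (\<lambda>x y \<gamma>. x \<gamma> + y \<gamma>),
     smult = (\<lambda>c x \<gamma>. scale c ` x \<gamma> + F_gt v \<gamma>)\<rparr>"

section \<open>Gradings\<close>

text \<open>\<open>A\<close> is the internal direct sum of the subspaces \<open>A\<^sub>\<delta>\<close>, and \<open>A\<^sub>\<delta> A\<^sub>\<epsilon> \<subseteq> A\<^sub>\<delta>\<^sub>+\<^sub>\<epsilon>\<close>.\<close>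

definition is_grading ::
    "('k::field \<Rightarrow> 'b \<Rightarrow> 'b) \<Rightarrow> 'b::comm_ring_1 set \<Rightarrow> ('d::ab_group_add \<Rightarrow> 'b set) \<Rightarrow> bool" where
  "is_grading scale A Agr \<longleftrightarrow>
    (\<forall>\<delta>. module.subspace scale (Agr \<delta>) \<and> Agr \<delta> \<subseteq> A) \<and>
    (\<forall>a\<in>A. \<exists>!c :: 'd \<Rightarrow>\<^sub>0 'b. (\<forall>\<delta>. Poly_Mapping.lookup c \<delta> \<in> Agr \<delta>) \<and>
        a = (\<Sum>\<delta>\<in>Poly_Mapping.keys c. Poly_Mapping.lookup c \<delta>)) \<and>
    (\<forall>\<delta> \<epsilon>. \<forall>a\<in>Agr \<delta>. \<forall>b\<in>Agr \<epsilon>. a * b \<in> Agr (\<delta> + \<epsilon>))"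

definition homogeneous :: "('d \<Rightarrow> 'b set) \<Rightarrow> 'b \<Rightarrow> bool" where
  "homogeneous Agr f \<longleftrightarrow> (\<exists>\<delta>. f \<in> Agr \<delta>)"

text \<open>Meaningful for non-zero homogeneous elements only.\<close>

definition deg :: "('d \<Rightarrow> 'b set) \<Rightarrow> 'b \<Rightarrow> 'd" where
  "deg Agr f = (THE \<delta>. f \<in> Agr \<delta>)"

definition finite_dimensional :: "('k::field \<Rightarrow> 'b \<Rightarrow> 'b::ab_group_add) \<Rightarrow> 'b set \<Rightarrow> bool" where
  "finite_dimensional scale V \<longleftrightarrow> (\<exists>S. finite S \<and> module.span scale S = V)"

definition fin_gen_group :: "'d::ab_group_add itself \<Rightarrow> bool" where
  "fin_gen_group _ \<longleftrightarrow> (\<exists>S :: 'd set. finite S \<and> group_closure S = UNIV)"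

section \<open>Homogeneous initial algebras\<close>

definition gr_tensor ::
    "('k::field \<Rightarrow> 'b \<Rightarrow> 'b::comm_ring_1) \<Rightarrow> ('b \<Rightarrow> 'g::linordered_ab_group_add) \<Rightarrow>
     ('k, (('g \<Rightarrow> 'b set) \<times> ('d::ab_group_add \<Rightarrow>\<^sub>0 'k) \<Rightarrow>\<^sub>0 'k) set) module" where
  "gr_tensor scale v = tensor_algebra (gr_algebra scale v) group_algebra"

definition hom_initial_form ::
    "('k::field \<Rightarrow> 'b \<Rightarrow> 'b::comm_ring_1) \<Rightarrow> ('b \<Rightarrow> 'g::linordered_ab_group_add) \<Rightarrow>
     ('d::ab_group_add \<Rightarrow> 'b set) \<Rightarrow> 'b \<Rightarrow> (('g \<Rightarrow> 'b set) \<times> ('d \<Rightarrow>\<^sub>0 'k) \<Rightarrow>\<^sub>0 'k) set" where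
  "hom_initial_form scale v Agr f =
    pure_tensor (gr_algebra scale v) group_algebra
      (initial_form v f) (Poly_Mapping.single (deg Agr f) 1)"

definition hom_initial_algebra ::
    "('k::field \<Rightarrow> 'b \<Rightarrow> 'b::comm_ring_1) \<Rightarrow> ('b \<Rightarrow> 'g::linordered_ab_group_add) \<Rightarrow>
     ('d::ab_group_add \<Rightarrow> 'b set) \<Rightarrow> 'b set \<Rightarrow> (('g \<Rightarrow> 'b set) \<times> ('d \<Rightarrow>\<^sub>0 'k) \<Rightarrow>\<^sub>0 'k) set set" where
  "hom_initial_algebra scale v Agr S =
    generated_subalgebra (gr_tensor scale v)
      {hom_initial_form scale v Agr f | f. f \<in> S \<and> f \<noteq> 0 \<and> homogeneous Agr f}"

section \<open>Homogeneous subduction\<close>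

text \<open>A state is \<open>(\<G>', h, r)\<close>. The indeterminate \<open>X\<^sub>g\<close> is indexed by \<open>g\<close> itself, so substituting
  \<open>f\<^sub>1, \<dots>, f\<^sub>k\<close> is evaluation at the identity assignment. The choice of \<open>fs = {f\<^sub>1, \<dots>, f\<^sub>k}\<close> and
  \<open>h'\<close> is nondeterministic, so that runs under every choice rule are covered.\<close>

type_synonym ('b, 'k) subduction_state = "'b set \<times> ('b, 'k) polynomial \<times> 'b"

definition subduction_loop_condition ::
    "('k::field \<Rightarrow> 'b \<Rightarrow> 'b::comm_ring_1) \<Rightarrow> ('b \<Rightarrow> 'g::linordered_ab_group_add) \<Rightarrow>
     ('d::ab_group_add \<Rightarrow> 'b set) \<Rightarrow> 'b set \<Rightarrow> 'b \<Rightarrow> bool" where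
  "subduction_loop_condition scale v Agr \<G> r \<longleftrightarrow>
    r \<noteq> 0 \<and> hom_initial_form scale v Agr r \<in> hom_initial_algebra scale v Agr \<G>"

definition subduction_choice ::
    "('k::field \<Rightarrow> 'b \<Rightarrow> 'b::comm_ring_1) \<Rightarrow> ('b \<Rightarrow> 'g::linordered_ab_group_add) \<Rightarrow>
     ('d::ab_group_add \<Rightarrow> 'b set) \<Rightarrow> 'b set \<Rightarrow> 'b \<Rightarrow> 'b set \<Rightarrow> ('b, 'k) polynomial \<Rightarrow> bool" where
  "subduction_choice scale v Agr \<G> r fs h' \<longleftrightarrow>
    finite fs \<and> fs \<subseteq> \<G> \<and> indets h' \<subseteq> fs \<and>
    eval_poly (gr_tensor scale v) (hom_initial_form scale v Agr) h' = hom_initial_form scale v Agr r \<and>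
    (\<forall>t\<in>Supp h'. v (eval_poly (type_algebra scale) id t) \<ge> v r \<and>
       deg Agr (eval_poly (type_algebra scale) id t) = deg Agr r)"

inductive subduction_step ::
    "('k::field \<Rightarrow> 'b \<Rightarrow> 'b::comm_ring_1) \<Rightarrow> ('b \<Rightarrow> 'g::linordered_ab_group_add) \<Rightarrow>
     ('d::ab_group_add \<Rightarrow> 'b set) \<Rightarrow> 'b set \<Rightarrow>
     ('b, 'k) subduction_state \<Rightarrow> ('b, 'k) subduction_state \<Rightarrow> bool"
  for scale v Agr \<G> where
  "\<lbrakk>subduction_loop_condition scale v Agr \<G> r; subduction_choice scale v Agr \<G> r fs h'\<rbrakk> \<Longrightarrow>
    subduction_step scale v Agr \<G> (\<G>', h, r)
      (\<G>' \<union> fs, h + h', r - eval_poly (type_algebra scale) id h')"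

text \<open>There is no infinite sequence of iterations, whatever choices are made.\<close>

definition subduction_terminates ::
    "('k::field \<Rightarrow> 'b \<Rightarrow> 'b::comm_ring_1) \<Rightarrow> ('b \<Rightarrow> 'g::linordered_ab_group_add) \<Rightarrow>
     ('d::ab_group_add \<Rightarrow> 'b set) \<Rightarrow> 'b set \<Rightarrow> 'b \<Rightarrow> bool" where
  "subduction_terminates scale v Agr \<G> f \<longleftrightarrow>
    (\<nexists>s :: nat \<Rightarrow> ('b, 'k) subduction_state.
       s 0 = ({}, 0, f) \<and> (\<forall>n. subduction_step scale v Agr \<G> (s n) (s (Suc n))))"

end

theory Submission
  imports Defs
begin

text \<open>
  In one iteration, all terms \<open>t\<close> of \<open>h'\<close> evaluate into the component of degree \<open>\<delta> = deg r\<close> and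
  have value at least \<open>v(r)\<close>. Comparing the parts of bidegree \<open>(v(r), \<delta>)\<close> in the equation
  \<open>h'(in f\<^sub>1, \<dots>, in f\<^sub>k) = in r\<close> shows that \<open>r - h'(f\<^sub>1, \<dots>, f\<^sub>k)\<close> vanishes or has value greater
  than \<open>v(r)\<close>. So the successive remainders stay in \<open>A\<^sub>\<delta>\<close> and have strictly increasing values.
  Non-zero elements with distinct values are linearly independent, hence there are at most
  \<open>dim A\<^sub>\<delta>\<close> of them.
\<close>

text \<open>Parts of given bidegree have to be compared inside a quotient of a free vector space
  whose basis vectors are themselves built from cosets. Instead of decomposing this quotient as a
  direct sum, the proof uses a linear map \<open>component \<gamma> \<delta>\<close> from the free
  space to \<open>B\<close> that sends all tensor relations into \<open>F_gt v \<gamma>\<close>. An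
  equation between tensors thereby becomes a congruence in \<open>B\<close> modulo
  \<open>F_gt v \<gamma>\<close>. To use it, both sides of the equation must be classes of explicit
  elements of the free space. For the side of h' this rests on multiplicativity: evaluating a
  monomial at homogeneous initial forms gives the homogeneous initial form of the value of the
  monomial. That in turn requires a well-defined product on the quotient and, for the empty
  monomial, that 1 has degree 0.\<close>

text \<open>The fold behind \<^const>\<open>finprod\<close> is evaluated directly, because the tensor product algebra is not
  available as a commutative monoid, which the library's rules for \<^const>\<open>finprod\<close> require.\<close>

lemma (in comm_monoid_set) finprod_hom:
  assumes one: "\<phi> \<^bold>1 = \<one>\<^bsub>N\<^esub>"
    and mult: "\<And>x y. x \<in> M \<Longrightarrow> y \<in> M \<Longrightarrow> \<phi> (x \<^bold>* y) = \<phi> x \<otimes>\<^bsub>N\<^esub> \<phi> y"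
    and M1: "\<^bold>1 \<in> M" and M: "\<And>x y. x \<in> M \<Longrightarrow> y \<in> M \<Longrightarrow> x \<^bold>* y \<in> M"
    and carr: "\<phi> ` M \<subseteq> carrier N"
    and A: "finite A" "g ` A \<subseteq> M"
    and h: "\<And>i. i \<in> A \<Longrightarrow> h i = \<phi> (g i)"
  shows "finprod N h A = \<phi> (F g A)"
proof -
  have FM: "F g T \<in> M" if "finite T" "T \<subseteq> A" for T
    using that by (induction T rule: finite_induct) (use A M1 M in auto)
  \<comment> \<open>Every order of folding computes the image under \<phi> of the same product in
    the source, so commutativity of the source makes the value of the fold unique.\<close>
  have det: "y = \<phi> (F g T)"
    if "(T, y) \<in> foldSetD (carrier N) (mult N \<circ> h) \<one>\<^bsub>N\<^esub>" "T \<subseteq> A" for T y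
    using that
  proof (induction rule: foldSetD.induct)
    case emptyI
    then show ?case by (simp add: one)
  next
    case (insertI x T y)
    have fin: "finite T" using insertI.hyps(3) by (rule foldSetD_imp_finite)
    then show ?case
      using insertI A h FM[OF fin] by (auto simp: mult)
  qed
  have ex: "(T, \<phi> (F g T)) \<in> foldSetD (carrier N) (mult N \<circ> h) \<one>\<^bsub>N\<^esub>"
    if "finite T" "T \<subseteq> A" for T
    using that
  proof (induction T rule: finite_induct)
    case empty
    then show ?case using one M1 carr by (auto intro!: foldSetD.emptyI)
  next
    case (insert x T)
    have "\<phi> (F g (insert x T)) = (mult N \<circ> h) x (\<phi> (F g T))"
      using insert A h FM[of T] by (auto simp: mult)
    moreover have "\<phi> (F g (insert x T)) \<in> carrier N"
      using insert FM[of "insert x T"] carr by auto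
    ultimately show ?case
      using insert by (auto intro!: foldSetD.insertI)
  qed
  show ?thesis
    unfolding finprod_def foldD_def
    using A(1) the_equality[of "\<lambda>y. (A, y) \<in> foldSetD (carrier N) (mult N \<circ> h) \<one>\<^bsub>N\<^esub>",
        OF ex[OF A(1) subset_refl] det[OF _ subset_refl]] by simp
qed

section \<open>Linear maps on free vector spaces, convolution and cosets\<close>

definition linear_extension :: "('k \<Rightarrow> 'c \<Rightarrow> 'c) \<Rightarrow> ('a \<Rightarrow> 'c) \<Rightarrow> ('a \<Rightarrow>\<^sub>0 'k::zero) \<Rightarrow> 'c::comm_monoid_add"
  where "linear_extension scale g p =
    (\<Sum>k\<in>Poly_Mapping.keys p. scale (Poly_Mapping.lookup p k) (g k))"

context vector_space
begin

text \<open>Summands outside the support vanish, so sums over different supports can be compared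
  over a common finite superset.\<close>

lemma linear_extension_superset:
  "finite T \<Longrightarrow> Poly_Mapping.keys p \<subseteq> T \<Longrightarrow>
    linear_extension scale g p = (\<Sum>k\<in>T. scale (Poly_Mapping.lookup p k) (g k))"
  unfolding linear_extension_def
  by (rule sum.mono_neutral_left) (auto simp: in_keys_iff)

lemma linear_extension_zero: "linear_extension scale g 0 = 0"
  by (simp add: linear_extension_def)

lemma linear_extension_add:
  "linear_extension scale g (p + q) = linear_extension scale g p + linear_extension scale g q"
proof -
  let ?T = "Poly_Mapping.keys p \<union> Poly_Mapping.keys q"
  have "Poly_Mapping.keys (p + q) \<subseteq> ?T" by (rule Poly_Mapping.keys_add)
  then show ?thesis
    by (subst (1 2 3) linear_extension_superset[of ?T])
      (auto simp: lookup_add scale_left_distrib sum.distrib)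
qed

lemma linear_extension_scale:
  "linear_extension scale g (pm_scale c p) = scale c (linear_extension scale g p)"
proof -
  have "Poly_Mapping.keys (pm_scale c p) \<subseteq> Poly_Mapping.keys p"
    by (auto simp: in_keys_iff lookup_pm_scale)
  then show ?thesis
    by (subst (1 2) linear_extension_superset[of "Poly_Mapping.keys p"])
      (auto simp: lookup_pm_scale scale_sum_right)
qed

lemma linear_extension_diff:
  "linear_extension scale g (p - q) = linear_extension scale g p - linear_extension scale g q"
  by (metis add_diff_cancel diff_add_cancel linear_extension_add)

lemma linear_extension_sum:
  "linear_extension scale g (\<Sum>i\<in>I. p i) = (\<Sum>i\<in>I. linear_extension scale g (p i))"
  by (induction I rule: infinite_finite_induct)
    (auto simp: linear_extension_zero linear_extension_add)

lemma linear_extension_single: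
  "linear_extension scale g (Poly_Mapping.single k c) = scale c (g k)"
  by (subst linear_extension_superset[of "{k}"]) auto

text \<open>With \<open>span_minimal\<close> this reduces a claim about all tensor relations to a
  check on their generators.\<close>

lemma subspace_linear_extension_vimage:
  assumes "subspace V"
  shows "module.subspace pm_scale {p. linear_extension scale g p \<in> V}"
proof -
  interpret pm: vector_space pm_scale by (rule vector_space_pm_scale)
  show ?thesis
    using assms
    by (auto simp: pm.subspace_def subspace_def linear_extension_zero linear_extension_add
        linear_extension_scale)
qed

end

text \<open>In a group the second exponent is determined as \<gamma> - \<alpha>, so the double sum
  of the convolution collapses to the single sum that also occurs in
  \<open>gr_algebra\<close>.\<close>

lemma lookup_mult_keys:
  fixes p q :: "'a::ab_group_add \<Rightarrow>\<^sub>0 'b::semiring_0"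
  shows "Poly_Mapping.lookup (p * q) \<gamma> =
    (\<Sum>\<alpha>\<in>Poly_Mapping.keys p. Poly_Mapping.lookup p \<alpha> * Poly_Mapping.lookup q (\<gamma> - \<alpha>))"
proof -
  have "(\<Sum>\<beta>. Poly_Mapping.lookup q \<beta> when \<gamma> = \<alpha> + \<beta>) = Poly_Mapping.lookup q (\<gamma> - \<alpha>)" for \<alpha>
  proof -
    have "(\<gamma> = \<alpha> + \<beta>) = (\<beta> = \<gamma> - \<alpha>)" for \<beta> by (auto simp: algebra_simps)
    then show ?thesis by simp
  qed
  then show ?thesis
    unfolding lookup_mult by (auto intro!: Sum_any.expand_superset simp: in_keys_iff)
qed

text \<open>The hypotheses say that \<open>F\<close> is an additive subgroup. The lemma serves for
  cosets of \<open>F_gt v \<gamma>\<close> and for cosets of the tensor relations alike.\<close>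

lemma set_plus_eq_iff:
  fixes a b :: "'b::ab_group_add"
  assumes "0 \<in> F" "\<And>x y. x \<in> F \<Longrightarrow> y \<in> F \<Longrightarrow> x - y \<in> F"
  shows "a +o F = b +o F \<longleftrightarrow> a - b \<in> F"
proof
  assume "a +o F = b +o F"
  moreover have "a \<in> a +o F" using assms(1) by (auto simp: elt_set_plus_def)
  ultimately show "a - b \<in> F" by (simp add: set_minus_plus)
next
  assume d: "a - b \<in> F"
  have neg: "b - a \<in> F" using assms(2)[OF assms(1) d] by simp
  have add: "x + y \<in> F" if "x \<in> F" "y \<in> F" for x y
    using assms(2)[OF that(1) assms(2)[OF assms(1) that(2)]] by simp
  show "a +o F = b +o F"
  proof (rule Set.set_eqI)
    fix x
    have "x - a = (x - b) + (b - a)" "x - b = (x - a) + (a - b)" by simp_all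
    then have "x - a \<in> F \<longleftrightarrow> x - b \<in> F" using add d neg by metis
    then show "x \<in> a +o F \<longleftrightarrow> x \<in> b +o F" by (simp add: set_minus_plus)
  qed
qed

section \<open>The associated graded algebra\<close>

locale valued_algebra = field_algebra scale + field_valuation scale v
  for scale :: "'k::field \<Rightarrow> 'b::idom \<Rightarrow> 'b"
    and v :: "'b \<Rightarrow> 'g::linordered_ab_group_add"
begin

lemma v_one: "v 1 = 0"
  using v_mult[of 1 1] by simp

lemma subspace_F_gt: "subspace (F_gt v \<gamma>)"
proof (rule subspaceI)
  fix x y assume "x \<in> F_gt v \<gamma>" "y \<in> F_gt v \<gamma>"
  then show "x + y \<in> F_gt v \<gamma>"
    using v_add[of x y] by (auto simp: F_gt_def min_def split: if_splits)
next
  fix c x assume "x \<in> F_gt v \<gamma>"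
  then show "scale c x \<in> F_gt v \<gamma>" using v_scale[of c x] by (cases "c = 0") (auto simp: F_gt_def)
qed (auto simp: F_gt_def)

lemma subspace_F_ge: "subspace (F_ge v \<gamma>)"
proof (rule subspaceI)
  fix x y assume "x \<in> F_ge v \<gamma>" "y \<in> F_ge v \<gamma>"
  then show "x + y \<in> F_ge v \<gamma>"
    using v_add[of x y] by (auto simp: F_ge_def min_def split: if_splits)
next
  fix c x assume "x \<in> F_ge v \<gamma>"
  then show "scale c x \<in> F_ge v \<gamma>" using v_scale[of c x] by (cases "c = 0") (auto simp: F_ge_def)
qed (auto simp: F_ge_def)

lemma F_gt_subset_F_ge: "F_gt v \<gamma> \<subseteq> F_ge v \<gamma>"
  by (auto simp: F_gt_def F_ge_def)

lemma F_ge_mult: "x \<in> F_ge v \<alpha> \<Longrightarrow> y \<in> F_ge v \<beta> \<Longrightarrow> x * y \<in> F_ge v (\<alpha> + \<beta>)"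
  by (auto simp: F_ge_def v_mult add_mono)

lemma F_gt_F_ge_mult: "x \<in> F_gt v \<alpha> \<Longrightarrow> y \<in> F_ge v \<beta> \<Longrightarrow> x * y \<in> F_gt v (\<alpha> + \<beta>)"
  by (auto simp: F_ge_def F_gt_def v_mult add_less_le_mono)

lemma F_ge_F_gt_mult: "x \<in> F_ge v \<alpha> \<Longrightarrow> y \<in> F_gt v \<beta> \<Longrightarrow> x * y \<in> F_gt v (\<alpha> + \<beta>)"
  by (auto simp: F_ge_def F_gt_def v_mult add_le_less_mono)

lemma scale_eq_mult: "scale c x = scale c 1 * x"
  by (simp add: scale_mult_left)

lemma coset_F_gt_eq_iff: "a +o F_gt v \<gamma> = b +o F_gt v \<gamma> \<longleftrightarrow> a - b \<in> F_gt v \<gamma>"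
  by (rule set_plus_eq_iff) (auto intro: subspace_0 subspace_diff subspace_F_gt)

lemma coset_F_gt_eq_F_gt_iff: "a +o F_gt v \<gamma> = F_gt v \<gamma> \<longleftrightarrow> a \<in> F_gt v \<gamma>"
  using coset_F_gt_eq_iff[of a \<gamma> 0] by simp

lemma F_gt_plus: "F_gt v \<gamma> + F_gt v \<gamma> = F_gt v \<gamma>"
proof
  show "F_gt v \<gamma> \<subseteq> F_gt v \<gamma> + F_gt v \<gamma>"
    by (rule set_zero_plus2) (rule subspace_0[OF subspace_F_gt])
  show "F_gt v \<gamma> + F_gt v \<gamma> \<subseteq> F_gt v \<gamma>"
    by (auto elim!: set_plus_elim intro: subspace_add subspace_F_gt)
qed

text \<open>When \<open>(a + x) * (b + y)\<close> is expanded, each summand other than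
  \<open>a * b\<close> has a factor in some \<open>F_gt\<close>, hence is zero or of value above
  \<alpha> + \<beta>. The added \<open>F_gt v (\<alpha> + \<beta>)\<close> yields the reverse
  inclusion.\<close>

lemma coset_F_gt_mult:
  assumes "a \<in> F_ge v \<alpha>" "b \<in> F_ge v \<beta>"
  shows "(a +o F_gt v \<alpha>) * (b +o F_gt v \<beta>) + F_gt v (\<alpha> + \<beta>) = (a * b) +o F_gt v (\<alpha> + \<beta>)"
    (is "?L = ?R")
proof
  let ?F = "F_gt v (\<alpha> + \<beta>)"
  show "?L \<subseteq> ?R"
  proof
    fix z assume "z \<in> ?L"
    then obtain x y w where z: "z = (a + x) * (b + y) + w"
      and xyw: "x \<in> F_gt v \<alpha>" "y \<in> F_gt v \<beta>" "w \<in> ?F"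
      by (auto elim!: set_plus_elim set_times_elim simp: elt_set_plus_def)
    have "a * y \<in> ?F" "x * b \<in> ?F" "x * y \<in> ?F"
      using F_ge_F_gt_mult[OF assms(1) xyw(2)] F_gt_F_ge_mult[OF xyw(1) assms(2)]
        F_gt_F_ge_mult[OF xyw(1)] xyw(2) F_gt_subset_F_ge by auto
    then have "a * y + x * b + x * y + w \<in> ?F"
      by (intro subspace_add[OF subspace_F_gt] xyw)
    moreover have "z - a * b = a * y + x * b + x * y + w"
      unfolding z by (simp add: algebra_simps)
    ultimately show "z \<in> ?R" by (simp flip: set_minus_plus)
  qed
  show "?R \<subseteq> ?L"
  proof
    fix z assume "z \<in> ?R"
    then obtain w where z: "z = a * b + w" "w \<in> ?F" by (auto simp: elt_set_plus_def)
    have "a \<in> a +o F_gt v \<alpha>" "b \<in> b +o F_gt v \<beta>"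
      by (auto simp: elt_set_plus_def intro: subspace_0 subspace_F_gt)
    then show "z \<in> ?L" unfolding z(1) using z(2) by (intro set_plus_intro set_times_intro)
  qed
qed

text \<open>The Rees algebra, inside the group ring of the value group over \<open>B\<close>. It maps onto the
  associated graded algebra, which thereby inherits the ring laws of the group ring.\<close>

definition rees :: "('g \<Rightarrow>\<^sub>0 'b) set" where
  "rees = {p. \<forall>\<gamma>. Poly_Mapping.lookup p \<gamma> \<in> F_ge v \<gamma>}"

definition gr_class :: "('g \<Rightarrow>\<^sub>0 'b) \<Rightarrow> 'g \<Rightarrow> 'b set" where
  "gr_class p = (\<lambda>\<gamma>. Poly_Mapping.lookup p \<gamma> +o F_gt v \<gamma>)"

text \<open>Scalars become factors of degree 0 in the Rees algebra, so compatibility of the product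
  with scalars turns into an instance of the ring laws.\<close>

lemma lookup_scalar_mult:
  fixes p :: "'g \<Rightarrow>\<^sub>0 'b"
  shows "Poly_Mapping.lookup (Poly_Mapping.single 0 (scale c 1) * p) \<gamma> =
    scale c (Poly_Mapping.lookup p \<gamma>)"
  unfolding lookup_mult_keys by (cases "c = 0") (auto simp flip: scale_eq_mult)

lemma rees_mult: "p \<in> rees \<Longrightarrow> q \<in> rees \<Longrightarrow> p * q \<in> rees"
proof -
  assume pq: "p \<in> rees" "q \<in> rees"
  have "Poly_Mapping.lookup p \<alpha> * Poly_Mapping.lookup q (\<gamma> - \<alpha>) \<in> F_ge v \<gamma>" for \<alpha> \<gamma>
    using pq F_ge_mult[of _ \<alpha> _ "\<gamma> - \<alpha>"] by (simp add: rees_def)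
  then show "p * q \<in> rees"
    by (auto simp: rees_def lookup_mult_keys intro: subspace_sum[OF subspace_F_ge])
qed

lemma rees_add: "p \<in> rees \<Longrightarrow> q \<in> rees \<Longrightarrow> p + q \<in> rees"
  by (auto simp: rees_def lookup_add intro: subspace_add subspace_F_ge)

lemma rees_single: "f \<in> F_ge v \<gamma> \<Longrightarrow> Poly_Mapping.single \<gamma> f \<in> rees"
  by (auto simp: rees_def lookup_single when_def intro: subspace_0 subspace_F_ge)

lemma rees_scalar: "Poly_Mapping.single 0 (scale c 1) \<in> rees"
  by (rule rees_single, rule subspace_scale[OF subspace_F_ge]) (simp add: F_ge_def v_one)

lemma carrier_gr_algebra: "carrier (gr_algebra scale v) = gr_class ` rees"
proof
  show "gr_class ` rees \<subseteq> carrier (gr_algebra scale v)"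
  proof
    fix x assume "x \<in> gr_class ` rees"
    then obtain p where p: "p \<in> rees" "x = gr_class p" by auto
    have "{\<gamma>. x \<gamma> \<noteq> F_gt v \<gamma>} \<subseteq> Poly_Mapping.keys p"
      by (auto simp: p gr_class_def in_keys_iff)
    then have "finite {\<gamma>. x \<gamma> \<noteq> F_gt v \<gamma>}" by (rule finite_subset) simp
    then show "x \<in> carrier (gr_algebra scale v)"
      using p by (auto simp: gr_algebra_def gr_component_def gr_class_def rees_def)
  qed
  show "carrier (gr_algebra scale v) \<subseteq> gr_class ` rees"
  proof
    fix x assume "x \<in> carrier (gr_algebra scale v)"
    then have x: "\<forall>\<gamma>. \<exists>f. f \<in> F_ge v \<gamma> \<and> x \<gamma> = f +o F_gt v \<gamma>"
      and fin: "finite {\<gamma>. x \<gamma> \<noteq> F_gt v \<gamma>}"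
      by (auto simp: gr_algebra_def gr_component_def)
    from x obtain a where a: "\<And>\<gamma>. a \<gamma> \<in> F_ge v \<gamma>" "\<And>\<gamma>. x \<gamma> = a \<gamma> +o F_gt v \<gamma>" by metis
    \<comment> \<open>Resetting the representatives of trivial cosets to 0 keeps the support
      finite.\<close>
    define p where "p = Poly_Mapping.Abs_poly_mapping (\<lambda>\<gamma>. if x \<gamma> = F_gt v \<gamma> then 0 else a \<gamma>)"
    have "finite {\<gamma>. (if x \<gamma> = F_gt v \<gamma> then 0 else a \<gamma>) \<noteq> 0}"
      by (rule finite_subset[OF _ fin]) auto
    then have lk: "Poly_Mapping.lookup p \<gamma> = (if x \<gamma> = F_gt v \<gamma> then 0 else a \<gamma>)" for \<gamma>
      unfolding p_def by simp
    have "p \<in> rees" using a(1) by (auto simp: rees_def lk intro: subspace_0 subspace_F_ge)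
    moreover have "x = gr_class p"
      by (rule ext) (use a(2) in \<open>auto simp: gr_class_def lk\<close>)
    ultimately show "x \<in> gr_class ` rees" by blast
  qed
qed

lemma gr_class_add:
  "gr_class p \<oplus>\<^bsub>gr_algebra scale v\<^esub> gr_class q = gr_class (p + q)"
  by (auto simp: gr_algebra_def gr_class_def lookup_add set_plus_rearrange F_gt_plus)

lemma gr_class_mult:
  assumes "p \<in> rees" "q \<in> rees"
  shows "gr_class p \<otimes>\<^bsub>gr_algebra scale v\<^esub> gr_class q = gr_class (p * q)"
proof
  fix \<gamma>
  let ?f = "\<lambda>\<alpha>. Poly_Mapping.lookup p \<alpha> * Poly_Mapping.lookup q (\<gamma> - \<alpha>)"
  let ?S = "{\<alpha>. gr_class p \<alpha> \<noteq> F_gt v \<alpha>}"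
  have S: "?S \<subseteq> Poly_Mapping.keys p" by (auto simp: gr_class_def in_keys_iff)
  have pq: "Poly_Mapping.lookup p \<alpha> \<in> F_ge v \<alpha>" "Poly_Mapping.lookup q \<alpha> \<in> F_ge v \<alpha>" for \<alpha>
    using assms by (auto simp: rees_def)
  \<comment> \<open>The elementwise products are completed to cosets one after another by a single
    copy of \<open>F_gt v \<gamma>\<close>, which the induction passes from each summand to the
    next.\<close>
  have sum: "(\<Sum>\<alpha>\<in>T. gr_class p \<alpha> * gr_class q (\<gamma> - \<alpha>)) + F_gt v \<gamma> = (\<Sum>\<alpha>\<in>T. ?f \<alpha>) +o F_gt v \<gamma>"
    if "finite T" for T
    using that
  proof (induction T rule: finite_induct)
    case empty
    then show ?case by simp
  next
    case (insert \<alpha> T)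
    let ?X = "gr_class p \<alpha> * gr_class q (\<gamma> - \<alpha>)"
    have X: "?X + F_gt v \<gamma> = ?f \<alpha> +o F_gt v \<gamma>"
      using coset_F_gt_mult[OF pq(1)[of \<alpha>] pq(2)[of "\<gamma> - \<alpha>"]] by (simp add: gr_class_def)
    have "(\<Sum>\<alpha>\<in>insert \<alpha> T. gr_class p \<alpha> * gr_class q (\<gamma> - \<alpha>)) + F_gt v \<gamma> =
        ?X + ((\<Sum>\<alpha>\<in>T. gr_class p \<alpha> * gr_class q (\<gamma> - \<alpha>)) + F_gt v \<gamma>)"
      using insert by (simp add: add.assoc)
    also have "\<dots> = (\<Sum>\<alpha>\<in>T. ?f \<alpha>) +o (?X + F_gt v \<gamma>)"
      unfolding insert.IH by (rule set_plus_rearrange4)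
    also have "\<dots> = (\<Sum>\<alpha>\<in>insert \<alpha> T. ?f \<alpha>) +o F_gt v \<gamma>"
      unfolding X set_plus_rearrange2 sum.insert[OF insert.hyps] by (simp only: add.commute)
    finally show ?case .
  qed
  have finS: "finite ?S" using S by (rule finite_subset) simp
  have "(gr_class p \<otimes>\<^bsub>gr_algebra scale v\<^esub> gr_class q) \<gamma> = (\<Sum>\<alpha>\<in>?S. ?f \<alpha>) +o F_gt v \<gamma>"
    using sum[OF finS] by (simp add: gr_algebra_def)
  \<comment> \<open>A degree in the support of \<open>p\<close> may still have a trivial class. The
    definition of the product omits such degrees, and the convolution includes them; their
    contribution lies in \<open>F_gt v \<gamma>\<close>.\<close>
  also have "\<dots> = (\<Sum>\<alpha>\<in>Poly_Mapping.keys p. ?f \<alpha>) +o F_gt v \<gamma>"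
  proof -
    have "?f \<alpha> \<in> F_gt v \<gamma>" if "\<alpha> \<in> Poly_Mapping.keys p - ?S" for \<alpha>
    proof -
      have "Poly_Mapping.lookup p \<alpha> \<in> F_gt v \<alpha>"
        using that by (auto simp: gr_class_def coset_F_gt_eq_F_gt_iff)
      from F_gt_F_ge_mult[OF this pq(2)[of "\<gamma> - \<alpha>"]] show ?thesis by simp
    qed
    then have "(\<Sum>\<alpha>\<in>Poly_Mapping.keys p - ?S. ?f \<alpha>) \<in> F_gt v \<gamma>"
      by (intro subspace_sum[OF subspace_F_gt])
    then have "(\<Sum>\<alpha>\<in>Poly_Mapping.keys p. ?f \<alpha>) - (\<Sum>\<alpha>\<in>?S. ?f \<alpha>) \<in> F_gt v \<gamma>"
      using S by (simp add: sum_diff)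
    then show ?thesis by (metis coset_F_gt_eq_iff)
  qed
  finally show "(gr_class p \<otimes>\<^bsub>gr_algebra scale v\<^esub> gr_class q) \<gamma> = gr_class (p * q) \<gamma>"
    by (simp add: gr_class_def lookup_mult_keys)
qed

lemma gr_class_scale:
  "c \<odot>\<^bsub>gr_algebra scale v\<^esub> gr_class p = gr_class (Poly_Mapping.single 0 (scale c 1) * p)"
proof
  fix \<gamma>
  let ?a = "Poly_Mapping.lookup p \<gamma>"
  \<comment> \<open>For \<open>c = 0\<close> the image of the coset is only \<open>{0}\<close>; the
    added \<open>F_gt v \<gamma>\<close> makes it a coset again.\<close>
  have "scale c ` (?a +o F_gt v \<gamma>) + F_gt v \<gamma> = scale c ?a +o F_gt v \<gamma>" (is "?L = ?R")
  proof
    show "?L \<subseteq> ?R"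
      by (auto elim!: set_plus_elim simp: elt_set_plus_def scale_right_distrib add.assoc
          intro!: subspace_add[OF subspace_F_gt] subspace_scale[OF subspace_F_gt])
    have "?a \<in> ?a +o F_gt v \<gamma>"
      by (auto simp: elt_set_plus_def intro: subspace_0 subspace_F_gt)
    then have "scale c ?a \<in> scale c ` (?a +o F_gt v \<gamma>)" by blast
    then show "?R \<subseteq> ?L" by (rule set_plus_mono3)
  qed
  then show "(c \<odot>\<^bsub>gr_algebra scale v\<^esub> gr_class p) \<gamma> =
      gr_class (Poly_Mapping.single 0 (scale c 1) * p) \<gamma>"
    by (simp add: gr_algebra_def gr_class_def lookup_scalar_mult)
qed

lemma one_gr_algebra: "\<one>\<^bsub>gr_algebra scale v\<^esub> = gr_class (Poly_Mapping.single 0 1)"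
  by (rule ext) (simp add: gr_algebra_def gr_class_def lookup_one when_def)

lemma initial_form_eq: "initial_form v f = gr_class (Poly_Mapping.single (v f) f)"
  by (rule ext) (auto simp: initial_form_def gr_class_def lookup_single when_def)

end

section \<open>The product of a tensor product of algebras\<close>

lemma pm_scale_single: "pm_scale c (Poly_Mapping.single k d) = Poly_Mapping.single k (c * d)"
  by (rule poly_mapping_eqI) (simp add: lookup_pm_scale lookup_single when_def)

interpretation pm: vector_space pm_scale
  by (rule vector_space_pm_scale)

text \<open>These laws support the product on a tensor product: closure keeps formal sums on the
  carriers, and linearity in the right argument together with commutativity makes the product
  respect the relations in both arguments.\<close>

locale comm_bilinear_algebra =
  fixes R :: "('k::field, 'a, 'm) module_scheme" (structure)
  assumes one_closed: "\<one> \<in> carrier R"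
    and mult_closed: "\<lbrakk>x \<in> carrier R; y \<in> carrier R\<rbrakk> \<Longrightarrow> x \<otimes> y \<in> carrier R"
    and add_closed: "\<lbrakk>x \<in> carrier R; y \<in> carrier R\<rbrakk> \<Longrightarrow> x \<oplus> y \<in> carrier R"
    and smult_closed: "x \<in> carrier R \<Longrightarrow> c \<odot> x \<in> carrier R"
    and mult_comm: "\<lbrakk>x \<in> carrier R; y \<in> carrier R\<rbrakk> \<Longrightarrow> x \<otimes> y = y \<otimes> x"
    and mult_add: "\<lbrakk>x \<in> carrier R; y \<in> carrier R; z \<in> carrier R\<rbrakk> \<Longrightarrow>
      x \<otimes> (y \<oplus> z) = (x \<otimes> y) \<oplus> (x \<otimes> z)"
    and mult_smult: "\<lbrakk>x \<in> carrier R; y \<in> carrier R\<rbrakk> \<Longrightarrow> x \<otimes> (c \<odot> y) = c \<odot> (x \<otimes> y)"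

locale tensor_factors = R: comm_bilinear_algebra R + S: comm_bilinear_algebra S
  for R :: "('k::field, 'a, 'm) module_scheme" and S :: "('k, 'c, 'n) module_scheme"
begin

abbreviation tmult :: "('a \<times> 'c \<Rightarrow>\<^sub>0 'k) \<Rightarrow> ('a \<times> 'c \<Rightarrow>\<^sub>0 'k) \<Rightarrow> ('a \<times> 'c \<Rightarrow>\<^sub>0 'k)" where
  "tmult \<equiv> mult (tensor_free R S)"

definition tensor_class :: "('a \<times> 'c \<Rightarrow>\<^sub>0 'k) \<Rightarrow> ('a \<times> 'c \<Rightarrow>\<^sub>0 'k) set" where
  "tensor_class p = p +o tensor_relations R S"

lemma subspace_relations: "pm.subspace (tensor_relations R S)"
  unfolding tensor_relations_def by (rule pm.subspace_span)

lemma subspace_carrier: "pm.subspace (carrier (tensor_free R S))"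
proof (rule pm.subspaceI)
  fix p q assume "p \<in> carrier (tensor_free R S)" "q \<in> carrier (tensor_free R S)"
  then show "p + q \<in> carrier (tensor_free R S)"
    using Poly_Mapping.keys_add[of p q] by (auto simp: tensor_free_def)
next
  fix c p assume "p \<in> carrier (tensor_free R S)"
  moreover have "Poly_Mapping.keys (pm_scale c p) \<subseteq> Poly_Mapping.keys p"
    by (auto simp: in_keys_iff lookup_pm_scale)
  ultimately show "pm_scale c p \<in> carrier (tensor_free R S)" by (auto simp: tensor_free_def)
qed (simp add: tensor_free_def)

lemma single_in_carrier:
  "\<lbrakk>a \<in> carrier R; b \<in> carrier S\<rbrakk> \<Longrightarrow> Poly_Mapping.single (a, b) c \<in> carrier (tensor_free R S)"
  by (simp add: tensor_free_def)

lemma relations_subset_carrier: "tensor_relations R S \<subseteq> carrier (tensor_free R S)"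
  unfolding tensor_relations_def
  by (rule pm.span_minimal[OF _ subspace_carrier])
    (auto intro!: pm.subspace_diff[OF subspace_carrier] single_in_carrier
      R.add_closed S.add_closed R.smult_closed S.smult_closed)

abbreviation left_mult :: "'a \<times> 'c \<Rightarrow> ('a \<times> 'c \<Rightarrow>\<^sub>0 'k) \<Rightarrow> ('a \<times> 'c \<Rightarrow>\<^sub>0 'k)" where
  "left_mult x \<equiv> linear_extension pm_scale
    (\<lambda>y. Poly_Mapping.single (fst x \<otimes>\<^bsub>R\<^esub> fst y, snd x \<otimes>\<^bsub>S\<^esub> snd y) 1)"

lemma left_mult_single:
  "left_mult (a, b) (Poly_Mapping.single (c, d) k) = Poly_Mapping.single (a \<otimes>\<^bsub>R\<^esub> c, b \<otimes>\<^bsub>S\<^esub> d) k"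
  by (simp add: pm.linear_extension_single pm_scale_single)

text \<open>The double sum is a nesting of two linear extensions, one for each factor, and
  biadditivity follows from this form.\<close>

lemma tmult_eq: "tmult p q = linear_extension pm_scale (\<lambda>x. left_mult x q) p"
  by (simp add: tensor_free_def linear_extension_def pm.scale_sum_right pm_scale_single case_prod_unfold)

lemma tmult_add_left: "tmult (p + p') q = tmult p q + tmult p' q"
  by (simp add: tmult_eq pm.linear_extension_add)

lemma tmult_add_right: "tmult p (q + q') = tmult p q + tmult p q'"
  by (simp add: tmult_eq pm.linear_extension_add)
    (simp add: linear_extension_def pm.scale_right_distrib sum.distrib)

lemma tmult_single:
  "tmult (Poly_Mapping.single (a, b) k) (Poly_Mapping.single (c, d) l) =
    Poly_Mapping.single (a \<otimes>\<^bsub>R\<^esub> c, b \<otimes>\<^bsub>S\<^esub> d) (k * l)"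
  by (simp add: tmult_eq pm.linear_extension_single pm_scale_single)

text \<open>This reduces relations in the left factor to relations in the right one. The restriction
  to the carrier comes from the factors, whose commutativity is assumed on their carriers.\<close>

lemma tmult_comm:
  assumes "p \<in> carrier (tensor_free R S)" "q \<in> carrier (tensor_free R S)"
  shows "tmult p q = tmult q p"
proof -
  have "tmult p q = (\<Sum>x\<in>Poly_Mapping.keys p. \<Sum>y\<in>Poly_Mapping.keys q. Poly_Mapping.single
      (fst x \<otimes>\<^bsub>R\<^esub> fst y, snd x \<otimes>\<^bsub>S\<^esub> snd y) (Poly_Mapping.lookup p x * Poly_Mapping.lookup q y))"
    by (simp add: tensor_free_def case_prod_unfold)
  also have "\<dots> = (\<Sum>x\<in>Poly_Mapping.keys p. \<Sum>y\<in>Poly_Mapping.keys q. Poly_Mapping.single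
      (fst y \<otimes>\<^bsub>R\<^esub> fst x, snd y \<otimes>\<^bsub>S\<^esub> snd x) (Poly_Mapping.lookup q y * Poly_Mapping.lookup p x))"
  proof (intro sum.cong refl)
    fix x y assume "x \<in> Poly_Mapping.keys p" "y \<in> Poly_Mapping.keys q"
    then have "fst x \<in> carrier R" "snd x \<in> carrier S" "fst y \<in> carrier R" "snd y \<in> carrier S"
      using assms by (auto simp: tensor_free_def)
    then show "Poly_Mapping.single (fst x \<otimes>\<^bsub>R\<^esub> fst y, snd x \<otimes>\<^bsub>S\<^esub> snd y)
          (Poly_Mapping.lookup p x * Poly_Mapping.lookup q y) =
        Poly_Mapping.single (fst y \<otimes>\<^bsub>R\<^esub> fst x, snd y \<otimes>\<^bsub>S\<^esub> snd x)
          (Poly_Mapping.lookup q y * Poly_Mapping.lookup p x)"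
      using R.mult_comm[of "fst x" "fst y"] S.mult_comm[of "snd x" "snd y"]
      by (simp add: mult.commute)
  qed
  also have "\<dots> = tmult q p"
    by (subst sum.swap) (simp add: tensor_free_def case_prod_unfold)
  finally show ?thesis .
qed

lemma relations_generators:
  shows "\<lbrakk>a \<in> carrier R; a' \<in> carrier R; b \<in> carrier S\<rbrakk> \<Longrightarrow>
      Poly_Mapping.single (a \<oplus>\<^bsub>R\<^esub> a', b) 1 - Poly_Mapping.single (a, b) 1
        - Poly_Mapping.single (a', b) 1 \<in> tensor_relations R S"
    and "\<lbrakk>a \<in> carrier R; b \<in> carrier S; b' \<in> carrier S\<rbrakk> \<Longrightarrow>
      Poly_Mapping.single (a, b \<oplus>\<^bsub>S\<^esub> b') 1 - Poly_Mapping.single (a, b) 1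
        - Poly_Mapping.single (a, b') 1 \<in> tensor_relations R S"
    and "\<lbrakk>a \<in> carrier R; b \<in> carrier S\<rbrakk> \<Longrightarrow>
      Poly_Mapping.single (c \<odot>\<^bsub>R\<^esub> a, b) 1 - Poly_Mapping.single (a, b) c \<in> tensor_relations R S"
    and "\<lbrakk>a \<in> carrier R; b \<in> carrier S\<rbrakk> \<Longrightarrow>
      Poly_Mapping.single (a, c \<odot>\<^bsub>S\<^esub> b) 1 - Poly_Mapping.single (a, b) c \<in> tensor_relations R S"
  unfolding tensor_relations_def by (rule pm.span_base; blast)+

text \<open>Left multiplication by a basis vector is linear and, since the products of both factors
  are linear in the right argument, takes each generating relation to a generating relation.\<close>

lemma left_mult_relations:
  assumes "a \<in> carrier R" "b \<in> carrier S" "q \<in> tensor_relations R S"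
  shows "left_mult (a, b) q \<in> tensor_relations R S"
proof -
  let ?V = "{q. left_mult (a, b) q \<in> tensor_relations R S}"
  have V: "pm.subspace ?V"
    by (rule pm.subspace_linear_extension_vimage[OF subspace_relations])
  have "tensor_relations R S \<subseteq> ?V"
    by (subst tensor_relations_def, rule pm.span_minimal[OF _ V])
      (auto simp: pm.linear_extension_diff left_mult_single[simplified] assms R.mult_add S.mult_add
        R.mult_smult S.mult_smult R.mult_closed S.mult_closed intro!: relations_generators)
  then show ?thesis using assms(3) by blast
qed

lemma tmult_relations_right:
  assumes "p \<in> carrier (tensor_free R S)" "q \<in> tensor_relations R S"
  shows "tmult p q \<in> tensor_relations R S"
proof -
  have "left_mult x q \<in> tensor_relations R S" if "x \<in> Poly_Mapping.keys p" for x
    using that assms left_mult_relations[of "fst x" "snd x" q] by (auto simp: tensor_free_def)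
  then show ?thesis
    unfolding tmult_eq linear_extension_def[of _ "\<lambda>x. left_mult x q"]
    by (intro pm.subspace_sum[OF subspace_relations] pm.subspace_scale[OF subspace_relations])
qed

lemma tensor_class_eq_iff: "tensor_class p = tensor_class q \<longleftrightarrow> p - q \<in> tensor_relations R S"
  unfolding tensor_class_def
  by (rule set_plus_eq_iff) (auto intro: pm.subspace_0 pm.subspace_diff subspace_relations)

lemma tensor_class_self: "p \<in> tensor_class p"
  unfolding tensor_class_def by (simp add: pm.subspace_0 subspace_relations flip: set_minus_plus)

lemma mem_tensor_class_iff: "p \<in> tensor_class q \<longleftrightarrow> p - q \<in> tensor_relations R S"
  by (simp add: tensor_class_def set_minus_plus)

lemma r_coset_tensor_free: "tensor_relations R S +>\<^bsub>tensor_free R S\<^esub> p = tensor_class p"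
  by (auto simp: a_r_coset_def' tensor_free_def tensor_class_def elt_set_plus_def add.commute)

lemma pure_tensor_eq: "pure_tensor R S a b = tensor_class (Poly_Mapping.single (a, b) 1)"
  by (simp add: pure_tensor_def r_coset_tensor_free)

lemma one_tensor_algebra: "\<one>\<^bsub>tensor_algebra R S\<^esub> = pure_tensor R S \<one>\<^bsub>R\<^esub> \<one>\<^bsub>S\<^esub>"
  by (simp add: tensor_algebra_def Let_def FactRing_def pure_tensor_def)
    (simp add: tensor_free_def)

lemma zero_tensor_algebra: "\<zero>\<^bsub>tensor_algebra R S\<^esub> = tensor_class 0"
  by (simp add: tensor_algebra_def Let_def FactRing_def tensor_class_def)

lemma tensor_class_in_carrier:
  "p \<in> carrier (tensor_free R S) \<Longrightarrow> tensor_class p \<in> carrier (tensor_algebra R S)"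
  by (auto simp: tensor_algebra_def Let_def FactRing_def A_RCOSETS_def' r_coset_tensor_free)

lemma tensor_class_add:
  "tensor_class p \<oplus>\<^bsub>tensor_algebra R S\<^esub> tensor_class q = tensor_class (p + q)"
proof -
  let ?I = "tensor_relations R S"
  have "?I + ?I \<subseteq> ?I"
    by (auto elim!: set_plus_elim intro: pm.subspace_add subspace_relations)
  moreover have "?I \<subseteq> ?I + ?I"
    by (rule set_zero_plus2) (rule pm.subspace_0[OF subspace_relations])
  ultimately have "?I + ?I = ?I" ..
  then have "tensor_class p + tensor_class q = tensor_class (p + q)"
    by (simp add: tensor_class_def set_plus_rearrange)
  moreover have "set_add (tensor_free R S) X Y = X + Y" for X Y
    by (auto simp: set_add_def' tensor_free_def set_plus_def)
  ultimately show ?thesis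
    by (simp add: tensor_algebra_def Let_def FactRing_def)
qed

text \<open>In the quotient this operation is a union over representatives. All members of the union
  are the same coset, and the union is not empty.\<close>

lemma tensor_class_smult:
  "c \<odot>\<^bsub>tensor_algebra R S\<^esub> tensor_class p = tensor_class (pm_scale c p)"
proof -
  have "tensor_class (pm_scale c q) = tensor_class (pm_scale c p)" if "q \<in> tensor_class p" for q
    using pm.subspace_scale[OF subspace_relations, of "q - p" c] that
    by (simp add: tensor_class_eq_iff mem_tensor_class_iff pm.scale_right_diff_distrib)
  then have "(\<Union>q\<in>tensor_class p. tensor_class (pm_scale c q)) = tensor_class (pm_scale c p)"
    using tensor_class_self[of p] by blast
  then show ?thesis
    by (simp add: tensor_algebra_def Let_def r_coset_tensor_free)
qed

text \<open>Exchanging the representatives changes the product by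
  \<open>tmult (p' - p) q' + tmult p (q' - q)\<close>. Both summands are relations, the first one
  after commuting its factors, for which \<open>q'\<close> has to lie in the carrier.\<close>

lemma tensor_class_mult:
  assumes p: "p \<in> carrier (tensor_free R S)" and q: "q \<in> carrier (tensor_free R S)"
  shows "tensor_class p \<otimes>\<^bsub>tensor_algebra R S\<^esub> tensor_class q = tensor_class (tmult p q)"
proof -
  have "tensor_class (tmult p' q') = tensor_class (tmult p q)"
    if "p' \<in> tensor_class p" "q' \<in> tensor_class q" for p' q'
  proof -
    have d: "p' - p \<in> tensor_relations R S" "q' - q \<in> tensor_relations R S"
      using that by (simp_all add: mem_tensor_class_iff)
    have q': "q' \<in> carrier (tensor_free R S)"
      using pm.subspace_add[OF subspace_carrier q, of "q' - q"] d(2) relations_subset_carrier by auto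
    have "tmult p' q' = tmult (p' - p) q' + (tmult p (q' - q) + tmult p q)"
      by (simp flip: tmult_add_left tmult_add_right)
    moreover have "tmult (p' - p) q' = tmult q' (p' - p)"
      using d(1) relations_subset_carrier q' by (intro tmult_comm) auto
    ultimately have "tmult p' q' - tmult p q = tmult q' (p' - p) + tmult p (q' - q)" by simp
    then show ?thesis
      using pm.subspace_add[OF subspace_relations tmult_relations_right[OF q' d(1)]
          tmult_relations_right[OF p d(2)]]
      by (simp add: tensor_class_eq_iff)
  qed
  then have "(\<Union>p'\<in>tensor_class p. \<Union>q'\<in>tensor_class q. tensor_class (tmult p' q')) =
      tensor_class (tmult p q)"
    using tensor_class_self[of p] tensor_class_self[of q] by blast
  then show ?thesis
    by (simp add: tensor_algebra_def Let_def FactRing_def rcoset_mult_def r_coset_tensor_free)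
qed

lemma pure_tensor_mult:
  assumes "a \<in> carrier R" "b \<in> carrier S" "c \<in> carrier R" "d \<in> carrier S"
  shows "pure_tensor R S a b \<otimes>\<^bsub>tensor_algebra R S\<^esub> pure_tensor R S c d =
    pure_tensor R S (a \<otimes>\<^bsub>R\<^esub> c) (b \<otimes>\<^bsub>S\<^esub> d)"
  using assms by (simp add: pure_tensor_eq tensor_class_mult single_in_carrier tmult_single)

lemma finsum_tensor_class:
  assumes "finite T" "\<And>i. i \<in> T \<Longrightarrow> p i \<in> carrier (tensor_free R S)"
    and "\<And>i. i \<in> T \<Longrightarrow> x i = tensor_class (p i)"
  shows "finsum (tensor_algebra R S) x T = tensor_class (\<Sum>i\<in>T. p i)"
  unfolding finsum_def
  by (rule sum.finprod_hom[where M = "carrier (tensor_free R S)"])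
    (use assms in \<open>auto simp: zero_tensor_algebra tensor_class_add tensor_class_in_carrier
      intro: pm.subspace_0 pm.subspace_add subspace_carrier\<close>)

end

section \<open>The tensor product with the group ring and its bihomogeneous components\<close>

lemma group_algebra_simps:
  "carrier group_algebra = UNIV" "mult group_algebra = (*)" "one group_algebra = 1"
  "add group_algebra = (+)" "smult group_algebra = pm_scale"
  by (simp_all add: group_algebra_def type_algebra_def)

lemma comm_bilinear_algebra_group_algebra: "comm_bilinear_algebra group_algebra"
proof -
  have scale: "pm_scale c p = Poly_Mapping.single 0 c * p" for c and p :: "'d::ab_group_add \<Rightarrow>\<^sub>0 'k::field"
    by (simp add: pm_scale_def mult_map_scale_conv_mult)
  show ?thesis
    by unfold_locales
      (auto simp: group_algebra_simps scale algebra_simps)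
qed

context valued_algebra
begin

lemma comm_bilinear_algebra_gr_algebra: "comm_bilinear_algebra (gr_algebra scale v)"
proof
  show "\<one>\<^bsub>gr_algebra scale v\<^esub> \<in> carrier (gr_algebra scale v)"
    unfolding carrier_gr_algebra one_gr_algebra
    by (intro imageI rees_single) (simp add: F_ge_def v_one)
qed (auto simp: carrier_gr_algebra gr_class_add gr_class_mult gr_class_scale
    rees_add rees_mult rees_scalar algebra_simps)

sublocale tensor_factors "gr_algebra scale v" "group_algebra :: ('k, 'd::ab_group_add \<Rightarrow>\<^sub>0 'k) module"
  by (intro tensor_factors.intro comm_bilinear_algebra_gr_algebra comm_bilinear_algebra_group_algebra)

lemma initial_form_in_carrier: "initial_form v f \<in> carrier (gr_algebra scale v)"
  unfolding initial_form_eq carrier_gr_algebra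
  by (intro imageI rees_single) (simp add: F_ge_def)

lemma initial_form_mult:
  assumes "f \<noteq> 0" "g \<noteq> 0"
  shows "initial_form v (f * g) = initial_form v f \<otimes>\<^bsub>gr_algebra scale v\<^esub> initial_form v g"
  using assms
  by (simp add: initial_form_eq gr_class_mult rees_single F_ge_def mult_single v_mult)

lemma initial_form_one: "initial_form v 1 = \<one>\<^bsub>gr_algebra scale v\<^esub>"
  by (simp add: initial_form_eq one_gr_algebra v_one)

text \<open>An arbitrary choice, hence linear on components of degree \<gamma> only modulo
  \<open>F_gt v \<gamma>\<close>; every conclusion drawn from it is a congruence modulo that
  subspace.\<close>

definition rep :: "'b set \<Rightarrow> 'b" where
  "rep X = (SOME f. f \<in> X)"

lemma rep_gr_class: "rep (gr_class p \<gamma>) - Poly_Mapping.lookup p \<gamma> \<in> F_gt v \<gamma>"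
proof -
  have "Poly_Mapping.lookup p \<gamma> \<in> gr_class p \<gamma>"
    by (simp add: gr_class_def subspace_0[OF subspace_F_gt] flip: set_minus_plus)
  then have "rep (gr_class p \<gamma>) \<in> gr_class p \<gamma>" unfolding rep_def by (rule someI)
  then show ?thesis by (simp add: gr_class_def set_minus_plus)
qed

text \<open>For \<open>v f = \<gamma>\<close> the component is the coset of \<open>f\<close>. For
  \<open>v f > \<gamma>\<close> both it and \<open>f\<close> are trivial modulo
  \<open>F_gt v \<gamma>\<close>, so terms whose value exceeds that of the remainder obey the same
  congruence as the leading ones.\<close>

lemma rep_initial_form:
  assumes "f \<noteq> 0" "v f \<ge> \<gamma>"
  shows "rep (initial_form v f \<gamma>) - f \<in> F_gt v \<gamma>"
proof (cases "v f = \<gamma>")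
  case True
  then show ?thesis
    using rep_gr_class[of "Poly_Mapping.single (v f) f" \<gamma>] by (simp add: initial_form_eq)
next
  case False
  then have "rep (initial_form v f \<gamma>) \<in> F_gt v \<gamma>" "f \<in> F_gt v \<gamma>"
    using assms rep_gr_class[of "Poly_Mapping.single (v f) f" \<gamma>]
    by (auto simp: initial_form_eq lookup_single when_def F_gt_def)
  then show ?thesis by (rule subspace_diff[OF subspace_F_gt])
qed

text \<open>A linear map from the free space underlying the tensor product to \<open>B\<close> which, modulo
  \<^term>\<open>F_gt v \<gamma>\<close>, extracts the component of bidegree \<open>(\<gamma>, \<delta>)\<close>.\<close>

definition component ::
    "'g \<Rightarrow> 'd \<Rightarrow> (('g \<Rightarrow> 'b set) \<times> ('d::ab_group_add \<Rightarrow>\<^sub>0 'k) \<Rightarrow>\<^sub>0 'k) \<Rightarrow> 'b" where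
  "component \<gamma> \<delta> = linear_extension scale
    (\<lambda>x. scale (Poly_Mapping.lookup (snd x) \<delta>) (rep (fst x \<gamma>)))"

lemma component_single:
  "component \<gamma> \<delta> (Poly_Mapping.single (x, p) c) =
    scale c (scale (Poly_Mapping.lookup p \<delta>) (rep (x \<gamma>)))"
  by (simp add: component_def linear_extension_single)

text \<open>Only generators need checking. For relations in the first factor, \<open>rep\<close>
  agrees with the linear \<open>lookup\<close> modulo \<open>F_gt v \<gamma>\<close>; relations in
  the second factor are sent to 0, because taking the coefficient at \<delta> is linear.\<close>

lemma component_relations:
  assumes "P \<in> tensor_relations (gr_algebra scale v) group_algebra"
  shows "component \<gamma> \<delta> P \<in> F_gt v \<gamma>"
proof -
  have add: "scale c (rep ((x \<oplus>\<^bsub>gr_algebra scale v\<^esub> y) \<gamma>)) - scale c (rep (x \<gamma>)) - scale c (rep (y \<gamma>))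
      \<in> F_gt v \<gamma>"
    if "x \<in> carrier (gr_algebra scale v)" "y \<in> carrier (gr_algebra scale v)" for c x y
  proof -
    from that obtain p q where pq: "x = gr_class p" "y = gr_class q"
      by (auto simp: carrier_gr_algebra)
    have "scale c ((rep (gr_class (p + q) \<gamma>) - Poly_Mapping.lookup (p + q) \<gamma>)
        - (rep (gr_class p \<gamma>) - Poly_Mapping.lookup p \<gamma>)
        - (rep (gr_class q \<gamma>) - Poly_Mapping.lookup q \<gamma>)) \<in> F_gt v \<gamma>"
      by (intro subspace_scale subspace_diff subspace_F_gt rep_gr_class)
    then show ?thesis
      by (simp add: pq gr_class_add lookup_add scale_right_diff_distrib scale_right_distrib algebra_simps)
  qed
  have smult: "scale d (rep ((c \<odot>\<^bsub>gr_algebra scale v\<^esub> x) \<gamma>)) - scale (c * d) (rep (x \<gamma>))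
      \<in> F_gt v \<gamma>"
    if "x \<in> carrier (gr_algebra scale v)" for c d x
  proof -
    from that obtain p where p: "x = gr_class p"
      by (auto simp: carrier_gr_algebra)
    let ?q = "Poly_Mapping.single 0 (scale c 1) * p"
    have "scale d ((rep (gr_class ?q \<gamma>) - Poly_Mapping.lookup ?q \<gamma>)
        - scale c (rep (gr_class p \<gamma>) - Poly_Mapping.lookup p \<gamma>)) \<in> F_gt v \<gamma>"
      by (intro subspace_scale subspace_diff subspace_F_gt rep_gr_class)
    then show ?thesis
      by (simp add: p gr_class_scale lookup_scalar_mult scale_right_diff_distrib mult.commute[of c d])
  qed
  have "tensor_relations (gr_algebra scale v) group_algebra \<subseteq> {P. component \<gamma> \<delta> P \<in> F_gt v \<gamma>}"
    unfolding tensor_relations_def component_def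
    by (rule pm.span_minimal[OF _ subspace_linear_extension_vimage[OF subspace_F_gt]])
      (auto simp: linear_extension_diff linear_extension_single add smult
        group_algebra_simps lookup_add lookup_pm_scale scale_left_distrib subspace_0[OF subspace_F_gt])
  then show ?thesis using assms by blast
qed

end

section \<open>Homogeneous initial forms\<close>

definition monomial_value :: "('b \<Rightarrow>\<^sub>0 nat) \<Rightarrow> 'b::comm_ring_1" where
  "monomial_value m = (\<Prod>g\<in>Poly_Mapping.keys m. g ^ Poly_Mapping.lookup m g)"

lemma nat_pow_type_algebra: "x [^]\<^bsub>type_algebra scale\<^esub> (n::nat) = x ^ n"
  by (induction n) (simp_all add: nat_pow_def type_algebra_def mult.commute)

lemma eval_type_algebra:
  "eval_poly (type_algebra scale) id h = linear_extension scale monomial_value h"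
proof -
  have "finprod (type_algebra scale) (\<lambda>g. id g [^]\<^bsub>type_algebra scale\<^esub> Poly_Mapping.lookup m g)
      (Poly_Mapping.keys m) = monomial_value m" for m
    unfolding monomial_value_def
    by (rule prod.finprod_hom[where M = UNIV and \<phi> = "\<lambda>x. x"])
      (auto simp: nat_pow_type_algebra, auto simp: type_algebra_def)
  then show ?thesis
    unfolding eval_poly_def linear_extension_def finsum_def
    by (intro sum.finprod_hom[where M = UNIV and \<phi> = "\<lambda>x. x"]) (auto, auto simp: type_algebra_def)
qed

locale graded_valued_algebra = valued_algebra scale v
  for scale :: "'k::field \<Rightarrow> 'b::idom \<Rightarrow> 'b"
    and v :: "'b \<Rightarrow> 'g::linordered_ab_group_add" +
  fixes A :: "'b set"
    and Agr :: "'d::ab_group_add \<Rightarrow> 'b set"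
  assumes grading: "is_grading scale A Agr"
    and one_in_A: "1 \<in> A"
begin

lemma subspace_Agr: "subspace (Agr \<delta>)"
  using grading by (simp add: is_grading_def)

lemma Agr_mult: "a \<in> Agr \<delta> \<Longrightarrow> b \<in> Agr \<epsilon> \<Longrightarrow> a * b \<in> Agr (\<delta> + \<epsilon>)"
  using grading by (simp add: is_grading_def)

lemma Agr_subset: "Agr \<delta> \<subseteq> A"
  using grading by (simp add: is_grading_def)

lemma decomposition_ex1:
  "a \<in> A \<Longrightarrow> \<exists>!c. (\<forall>\<delta>. Poly_Mapping.lookup c \<delta> \<in> Agr \<delta>) \<and>
    a = (\<Sum>\<delta>\<in>Poly_Mapping.keys c. Poly_Mapping.lookup c \<delta>)"
  using grading by (simp add: is_grading_def)

lemma decomposition_homogeneous: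
  assumes "a \<in> Agr \<delta>" "\<And>\<epsilon>. Poly_Mapping.lookup c \<epsilon> \<in> Agr \<epsilon>"
    and "a = (\<Sum>\<epsilon>\<in>Poly_Mapping.keys c. Poly_Mapping.lookup c \<epsilon>)"
  shows "c = Poly_Mapping.single \<delta> a"
proof -
  have "\<forall>\<epsilon>. Poly_Mapping.lookup (Poly_Mapping.single \<delta> a) \<epsilon> \<in> Agr \<epsilon>"
    using assms(1) by (auto simp: lookup_single when_def intro: subspace_0 subspace_Agr)
  moreover have "a = (\<Sum>\<epsilon>\<in>Poly_Mapping.keys (Poly_Mapping.single \<delta> a).
      Poly_Mapping.lookup (Poly_Mapping.single \<delta> a) \<epsilon>)"
    by simp
  ultimately show ?thesis
    using decomposition_ex1[of a] Agr_subset assms by blast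
qed

text \<open>Two degrees of \<open>a\<close> would give two decompositions of \<open>a\<close>. This
  is what makes the \<open>THE\<close> in \<open>deg\<close> meaningful.\<close>

lemma degree_unique:
  assumes "a \<noteq> 0" "a \<in> Agr \<delta>" "a \<in> Agr \<epsilon>"
  shows "\<delta> = \<epsilon>"
proof -
  have "Poly_Mapping.single \<epsilon> a = Poly_Mapping.single \<delta> a"
    by (rule decomposition_homogeneous)
      (use assms in \<open>auto simp: lookup_single when_def intro: subspace_0 subspace_Agr\<close>)
  then show ?thesis using assms(1) by (metis lookup_single_eq lookup_single_not_eq)
qed

lemma deg_eq: "a \<noteq> 0 \<Longrightarrow> a \<in> Agr \<delta> \<Longrightarrow> deg Agr a = \<delta>"
  unfolding deg_def by (rule the_equality) (auto dest: degree_unique)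

text \<open>If \<open>a\<close> is a non-zero homogeneous component of 1, then comparing \<open>a = \<Sum>\<^sub>\<delta> a 1\<^sub>\<delta>\<close> with the
  trivial decomposition of \<open>a\<close> gives \<open>a 1\<^sub>0 = a\<close>, and \<open>a\<close> can be cancelled.\<close>

lemma one_in_Agr_zero: "1 \<in> Agr 0"
proof -
  from decomposition_ex1[OF one_in_A] obtain c
    where c: "\<And>\<delta>. Poly_Mapping.lookup c \<delta> \<in> Agr \<delta>"
      and sum_c: "1 = (\<Sum>\<delta>\<in>Poly_Mapping.keys c. Poly_Mapping.lookup c \<delta>)"
    by blast
  have "Poly_Mapping.keys c \<noteq> {}" using sum_c by auto
  then obtain \<alpha> where \<alpha>: "\<alpha> \<in> Poly_Mapping.keys c" by blast
  define a where "a = Poly_Mapping.lookup c \<alpha>"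
  have a: "a \<noteq> 0" "a \<in> Agr \<alpha>" using \<alpha> c by (auto simp: a_def in_keys_iff)
  \<comment> \<open>In the group ring of \<Delta> over \<open>B\<close>, this product puts
    \<open>a\<close> times the component of 1 of degree \<delta> in degree \<alpha> + \<delta>,
    which gives the decomposition of \<open>a * 1\<close>. Its support is a translate of that of
    \<open>c\<close> because \<open>B\<close> is a domain.\<close>
  define c' where "c' = Poly_Mapping.single \<alpha> a * c"
  have lk: "Poly_Mapping.lookup c' \<epsilon> = a * Poly_Mapping.lookup c (\<epsilon> - \<alpha>)" for \<epsilon>
    unfolding c'_def lookup_mult_keys using a by simp
  have keys: "Poly_Mapping.keys c' = (\<lambda>\<delta>. \<alpha> + \<delta>) ` Poly_Mapping.keys c"
  proof (intro equalityI subsetI)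
    fix \<epsilon> assume "\<epsilon> \<in> Poly_Mapping.keys c'"
    then have "\<epsilon> - \<alpha> \<in> Poly_Mapping.keys c" by (simp add: in_keys_iff lk)
    then show "\<epsilon> \<in> (\<lambda>\<delta>. \<alpha> + \<delta>) ` Poly_Mapping.keys c"
      by (intro image_eqI[of _ _ "\<epsilon> - \<alpha>"]) auto
  qed (use a(1) in \<open>auto simp: in_keys_iff lk\<close>)
  have "Poly_Mapping.lookup c' \<epsilon> \<in> Agr \<epsilon>" for \<epsilon>
    using Agr_mult[OF a(2) c[of "\<epsilon> - \<alpha>"]] by (simp add: lk)
  moreover have "a = (\<Sum>\<delta>\<in>Poly_Mapping.keys c'. Poly_Mapping.lookup c' \<delta>)"
    using sum_c by (simp add: keys sum.reindex lk flip: sum_distrib_left)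
  ultimately have "c' = Poly_Mapping.single \<alpha> a"
    by (rule decomposition_homogeneous[OF a(2)])
  then have "a * Poly_Mapping.lookup c 0 = a" using lk[of \<alpha>] by simp
  then show ?thesis using a(1) c[of 0] by simp
qed

text \<open>A multiplicative submonoid, because \<open>B\<close> is a domain. On it
  \<open>deg\<close> is meaningful and \<open>hif\<close> is multiplicative, so it serves as the set
  \<open>M\<close> in \<open>finprod_hom\<close>.\<close>

definition nonzero_homogeneous :: "'b set" where
  "nonzero_homogeneous = {f. f \<noteq> 0 \<and> homogeneous Agr f}"

lemma Agr_deg: "f \<in> nonzero_homogeneous \<Longrightarrow> f \<in> Agr (deg Agr f)"
  using deg_eq by (auto simp: nonzero_homogeneous_def homogeneous_def)

lemma one_nonzero_homogeneous: "1 \<in> nonzero_homogeneous"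
  using one_in_Agr_zero by (auto simp: nonzero_homogeneous_def homogeneous_def)

lemma mult_nonzero_homogeneous:
  "\<lbrakk>f \<in> nonzero_homogeneous; g \<in> nonzero_homogeneous\<rbrakk> \<Longrightarrow> f * g \<in> nonzero_homogeneous"
  using Agr_mult by (fastforce simp: nonzero_homogeneous_def homogeneous_def)

lemma power_nonzero_homogeneous: "f \<in> nonzero_homogeneous \<Longrightarrow> f ^ n \<in> nonzero_homogeneous"
  by (induction n) (simp_all add: one_nonzero_homogeneous mult_nonzero_homogeneous)

lemma deg_mult:
  assumes "f \<in> nonzero_homogeneous" "g \<in> nonzero_homogeneous"
  shows "deg Agr (f * g) = deg Agr f + deg Agr g"
  using assms Agr_mult[OF Agr_deg Agr_deg] by (intro deg_eq) (auto simp: nonzero_homogeneous_def)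

lemma monomial_value_nonzero_homogeneous:
  assumes "Poly_Mapping.keys m \<subseteq> nonzero_homogeneous"
  shows "monomial_value m \<in> nonzero_homogeneous"
proof -
  have "(\<Prod>g\<in>T. g ^ Poly_Mapping.lookup m g) \<in> nonzero_homogeneous"
    if "finite T" "T \<subseteq> Poly_Mapping.keys m" for T
    using that assms
    by (induction T rule: finite_induct)
      (auto simp: one_nonzero_homogeneous mult_nonzero_homogeneous power_nonzero_homogeneous subset_iff)
  then show ?thesis by (simp add: monomial_value_def)
qed

section \<open>Evaluation at homogeneous initial forms and the gain of one iteration\<close>

abbreviation hif :: "'b \<Rightarrow> (('g \<Rightarrow> 'b set) \<times> ('d \<Rightarrow>\<^sub>0 'k) \<Rightarrow>\<^sub>0 'k) set" where
  "hif \<equiv> hom_initial_form scale v Agr"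

abbreviation T :: "('k, (('g \<Rightarrow> 'b set) \<times> ('d \<Rightarrow>\<^sub>0 'k) \<Rightarrow>\<^sub>0 'k) set) module" where
  "T \<equiv> gr_tensor scale v"

definition hif_rep :: "'b \<Rightarrow> (('g \<Rightarrow> 'b set) \<times> ('d \<Rightarrow>\<^sub>0 'k) \<Rightarrow>\<^sub>0 'k)" where
  "hif_rep f = Poly_Mapping.single (initial_form v f, Poly_Mapping.single (deg Agr f) 1) 1"

lemma hif_eq: "hif f = tensor_class (hif_rep f)"
  by (simp add: hom_initial_form_def pure_tensor_eq hif_rep_def)

lemma hif_rep_in_carrier: "hif_rep f \<in> carrier (tensor_free (gr_algebra scale v) group_algebra)"
  unfolding hif_rep_def
  by (intro single_in_carrier initial_form_in_carrier) (simp add: group_algebra_simps)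

lemma hif_in_carrier: "hif f \<in> carrier T"
  unfolding hif_eq gr_tensor_def by (intro tensor_class_in_carrier hif_rep_in_carrier)

lemma hif_one: "hif 1 = \<one>\<^bsub>T\<^esub>"
  by (simp add: hom_initial_form_def gr_tensor_def one_tensor_algebra initial_form_one
      deg_eq[OF _ one_in_Agr_zero] group_algebra_simps)

lemma hif_mult:
  assumes "f \<in> nonzero_homogeneous" "g \<in> nonzero_homogeneous"
  shows "hif (f * g) = hif f \<otimes>\<^bsub>T\<^esub> hif g"
proof -
  have "Poly_Mapping.single (deg Agr (f * g)) 1 =
      Poly_Mapping.single (deg Agr f) (1::'k) \<otimes>\<^bsub>group_algebra\<^esub> Poly_Mapping.single (deg Agr g) 1"
    by (simp add: deg_mult[OF assms] group_algebra_simps mult_single)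
  moreover have "initial_form v (f * g) = initial_form v f \<otimes>\<^bsub>gr_algebra scale v\<^esub> initial_form v g"
    using assms by (intro initial_form_mult) (auto simp: nonzero_homogeneous_def)
  ultimately show ?thesis
    by (simp add: hom_initial_form_def gr_tensor_def initial_form_in_carrier pure_tensor_mult
        group_algebra_simps)
qed

lemma hif_power: "f \<in> nonzero_homogeneous \<Longrightarrow> hif f [^]\<^bsub>T\<^esub> (n::nat) = hif (f ^ n)"
proof (induction n)
  case 0
  then show ?case by (simp add: nat_pow_def hif_one)
next
  case (Suc n)
  then show ?case
    using hif_mult[OF power_nonzero_homogeneous[of f n], of f]
    by (simp add: nat_pow_def mult.commute)
qed

lemma hif_monomial_value:
  assumes "Poly_Mapping.keys m \<subseteq> nonzero_homogeneous"
  shows "finprod T (\<lambda>g. hif g [^]\<^bsub>T\<^esub> Poly_Mapping.lookup m g) (Poly_Mapping.keys m) =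
    hif (monomial_value m)"
  unfolding monomial_value_def
  by (rule prod.finprod_hom[where M = nonzero_homogeneous])
    (use assms in \<open>auto simp: hif_one hif_mult hif_power hif_in_carrier one_nonzero_homogeneous
      mult_nonzero_homogeneous power_nonzero_homogeneous subset_iff\<close>)

text \<open>Exhibits a representative in the free space, to which the linear map
  \<open>component\<close> can be applied.\<close>

lemma eval_hif:
  assumes "indets h \<subseteq> nonzero_homogeneous"
  shows "eval_poly T hif h =
    tensor_class (linear_extension pm_scale (\<lambda>m. hif_rep (monomial_value m)) h)"
  unfolding eval_poly_def linear_extension_def gr_tensor_def
proof (rule finsum_tensor_class)
  fix m assume m: "m \<in> Poly_Mapping.keys h"
  then show "pm_scale (Poly_Mapping.lookup h m) (hif_rep (monomial_value m))
      \<in> carrier (tensor_free (gr_algebra scale v) group_algebra)"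
    by (intro pm.subspace_scale subspace_carrier hif_rep_in_carrier)
  from m assms have "Poly_Mapping.keys m \<subseteq> nonzero_homogeneous" by (auto simp: indets_def)
  from hif_monomial_value[OF this]
  show "Poly_Mapping.lookup h m \<odot>\<^bsub>tensor_algebra (gr_algebra scale v) group_algebra\<^esub>
      finprod (tensor_algebra (gr_algebra scale v) group_algebra)
        (\<lambda>i. hif i [^]\<^bsub>tensor_algebra (gr_algebra scale v) group_algebra\<^esub> Poly_Mapping.lookup m i)
        (Poly_Mapping.keys m) =
      tensor_class (pm_scale (Poly_Mapping.lookup h m) (hif_rep (monomial_value m)))"
    by (simp add: gr_tensor_def hif_eq tensor_class_smult)
qed simp

lemma component_hif_rep: "component \<gamma> (deg Agr f) (hif_rep f) = rep (initial_form v f \<gamma>)"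
  by (simp add: hif_rep_def component_single)

lemma subduction_step_remainder:
  assumes r: "r \<noteq> 0" "r \<in> Agr \<delta>" and G: "\<G> \<subseteq> nonzero_homogeneous"
    and choice: "subduction_choice scale v Agr \<G> r fs h"
  shows "r - eval_poly (type_algebra scale) id h \<in> Agr \<delta> \<inter> F_gt v (v r)"
proof
  let ?m = "\<lambda>m. monomial_value m :: 'b"
  let ?c = "Poly_Mapping.lookup h"
  let ?s = "\<Sum>m\<in>Poly_Mapping.keys h. scale (?c m) (?m m)"
  have indets: "indets h \<subseteq> nonzero_homogeneous"
    using choice G by (auto simp: subduction_choice_def)
  have eval: "eval_poly (type_algebra scale) id h = ?s"
    by (simp add: eval_type_algebra linear_extension_def)
  have deg_r: "deg Agr r = \<delta>" using deg_eq r by blast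
  \<comment> \<open>The choice condition bounds terms with their coefficients. Non-zero scalars
    change neither value nor degree, so the bounds pass to the bare monomials.\<close>
  have summand: "?m m \<noteq> 0" "?m m \<in> Agr \<delta>" "deg Agr (?m m) = \<delta>" "v (?m m) \<ge> v r"
    if m: "m \<in> Poly_Mapping.keys h" for m
  proof -
    have c: "?c m \<noteq> 0" using m by (simp add: in_keys_iff)
    have "Poly_Mapping.keys m \<subseteq> nonzero_homogeneous"
      using m indets by (auto simp: indets_def)
    then have hom: "?m m \<in> nonzero_homogeneous" by (rule monomial_value_nonzero_homogeneous)
    then show nz: "?m m \<noteq> 0" by (simp add: nonzero_homogeneous_def)
    have "Poly_Mapping.single m (?c m) \<in> Supp h" using m by (auto simp: Supp_def)
    then have t: "v (scale (?c m) (?m m)) \<ge> v r" "deg Agr (scale (?c m) (?m m)) = \<delta>"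
      using choice deg_r
      by (auto simp: subduction_choice_def eval_type_algebra linear_extension_single)
    show "v (?m m) \<ge> v r" using t(1) v_scale[OF c nz] by simp
    have "scale (?c m) (?m m) \<in> Agr (deg Agr (?m m))"
      by (intro subspace_scale subspace_Agr Agr_deg hom)
    then show d: "deg Agr (?m m) = \<delta>" using t(2) deg_eq[of "scale (?c m) (?m m)"] c nz by simp
    show "?m m \<in> Agr \<delta>" using Agr_deg[OF hom] d by simp
  qed
  show "r - eval_poly (type_algebra scale) id h \<in> Agr \<delta>"
    unfolding eval
    by (intro subspace_diff subspace_sum subspace_scale subspace_Agr r summand)
  have "tensor_class (linear_extension pm_scale (\<lambda>m. hif_rep (?m m)) h) = tensor_class (hif_rep r)"
    using choice eval_hif[OF indets] by (simp add: subduction_choice_def hif_eq)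
  then have "component (v r) \<delta> (linear_extension pm_scale (\<lambda>m. hif_rep (?m m)) h - hif_rep r)
      \<in> F_gt v (v r)"
    by (intro component_relations) (simp add: tensor_class_eq_iff)
  moreover have "component (v r) \<delta> (linear_extension pm_scale (\<lambda>m. hif_rep (?m m)) h) =
      (\<Sum>m\<in>Poly_Mapping.keys h. scale (?c m) (rep (initial_form v (?m m) (v r))))"
  proof -
    have "component (v r) \<delta> (hif_rep (?m m)) = rep (initial_form v (?m m) (v r))"
      if "m \<in> Poly_Mapping.keys h" for m
      using component_hif_rep[of "v r" "?m m"] summand(3)[OF that] by simp
    then show ?thesis
      by (simp add: linear_extension_def[of pm_scale] component_def linear_extension_sum
          linear_extension_scale)
  qed
  moreover have "component (v r) \<delta> (hif_rep r) = rep (initial_form v r (v r))"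
    using component_hif_rep[of "v r" r] deg_r by simp
  ultimately have 1: "(\<Sum>m\<in>Poly_Mapping.keys h. scale (?c m) (rep (initial_form v (?m m) (v r))))
      - rep (initial_form v r (v r)) \<in> F_gt v (v r)"
    by (simp add: component_def linear_extension_diff)
  have 2: "(\<Sum>m\<in>Poly_Mapping.keys h. scale (?c m) (rep (initial_form v (?m m) (v r)) - ?m m))
      \<in> F_gt v (v r)"
    by (intro subspace_sum subspace_scale subspace_F_gt rep_initial_form summand)
  have 3: "rep (initial_form v r (v r)) - r \<in> F_gt v (v r)"
    using r by (intro rep_initial_form) auto
  \<comment> \<open>Facts 2 and 3 trade the chosen representatives for the monomial values and for
    \<open>r\<close>; fact 1 is the tensor equation read modulo \<open>F_gt v (v r)\<close>.\<close>
  have eq: "r - ?s = (\<Sum>m\<in>Poly_Mapping.keys h. scale (?c m) (rep (initial_form v (?m m) (v r)) - ?m m))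
      - ((\<Sum>m\<in>Poly_Mapping.keys h. scale (?c m) (rep (initial_form v (?m m) (v r))))
        - rep (initial_form v r (v r)))
      - (rep (initial_form v r (v r)) - r)"
    by (simp add: scale_right_diff_distrib sum_subtractf)
  show "r - eval_poly (type_algebra scale) id h \<in> F_gt v (v r)"
    unfolding eval eq by (intro subspace_diff[OF subspace_F_gt subspace_diff[OF subspace_F_gt]] 1 2 3)
qed

end

section \<open>Linear independence from strictly increasing values\<close>

context valued_algebra
begin

text \<open>The element of least value is added last: the span of the others lies in the subspace
  \<open>F_gt v (v (r m))\<close>, which does not contain \<open>r m\<close>. The start
  \<open>m\<close> is arbitrary so that the induction hypothesis applies from \<open>Suc m\<close>
  on.\<close>

lemma independent_of_increasing_values:
  fixes r :: "nat \<Rightarrow> 'b"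
  assumes nz: "\<And>n. r n \<noteq> 0" and inc: "strict_mono (\<lambda>n. v (r n))"
  shows "independent (r ` {m..<m + n})"
proof (induction n arbitrary: m)
  case 0
  then show ?case by (simp add: independent_empty)
next
  case (Suc n)
  have "r ` {Suc m..<Suc m + n} \<subseteq> F_gt v (v (r m))"
    using strict_monoD[OF inc] by (auto simp: F_gt_def)
  then have "span (r ` {Suc m..<Suc m + n}) \<subseteq> F_gt v (v (r m))"
    by (rule span_minimal[OF _ subspace_F_gt])
  moreover have "r m \<notin> F_gt v (v (r m))" using nz by (simp add: F_gt_def)
  ultimately have "independent (insert (r m) (r ` {Suc m..<Suc m + n}))"
    by (intro independent_insertI Suc.IH) auto
  moreover have "{m..<m + Suc n} = insert m {Suc m..<Suc m + n}" by auto
  ultimately show ?case by simp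
qed

lemma no_increasing_values_finite_dimensional:
  fixes r :: "nat \<Rightarrow> 'b"
  assumes V: "finite_dimensional scale V" "\<And>n. r n \<in> V"
    and nz: "\<And>n. r n \<noteq> 0" and inc: "strict_mono (\<lambda>n. v (r n))"
  shows False
proof -
  obtain S where S: "finite S" "span S = V"
    using V(1) by (auto simp: finite_dimensional_def)
  \<comment> \<open>One element more than the spanning set has, against the bound on independent
    sets.\<close>
  define X where "X = r ` {0..<0 + Suc (card S)}"
  have "inj (\<lambda>n. v (r n))" by (rule strict_mono_imp_inj_on[OF inc])
  then have "inj r" by (metis injD injI)
  then have "card X = Suc (card S)"
    unfolding X_def by (subst card_image) (auto intro: inj_on_subset)
  moreover have "independent X"
    unfolding X_def by (rule independent_of_increasing_values[OF nz inc])
  then have "card X \<le> card S"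
    using independent_span_bound[OF S(1)] S(2) V(2) by (auto simp: X_def)
  ultimately show False by simp
qed

end

theorem proposition2p15:
  fixes scale :: "'k::field \<Rightarrow> 'b::idom \<Rightarrow> 'b"
    and v :: "'b \<Rightarrow> 'g::linordered_ab_group_add"
    and A :: "'b set"
    and Agr :: "'d::ab_group_add \<Rightarrow> 'b set"
  assumes "field_algebra scale"
    and "fin_gen_subalgebra (type_algebra scale) (UNIV :: 'b set)"
    and "fin_gen_subalgebra (type_algebra scale) A"
    and "field_valuation scale v"
    and "fin_gen_group TYPE('d)"
    and "is_grading scale A Agr"
    and "\<forall>\<delta>. finite_dimensional scale (Agr \<delta>)"
  shows "\<forall>f \<G>. f \<in> A \<and> homogeneous Agr f \<and>
             \<G> \<subseteq> A \<and> (\<forall>g\<in>\<G>. g \<noteq> 0 \<and> homogeneous Agr g) \<longrightarrow>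
           subduction_terminates scale v Agr \<G> f"
proof (intro allI impI)
  fix f \<G>
  assume f\<G>: "f \<in> A \<and> homogeneous Agr f \<and> \<G> \<subseteq> A \<and> (\<forall>g\<in>\<G>. g \<noteq> 0 \<and> homogeneous Agr g)"
  have "\<one>\<^bsub>type_algebra scale\<^esub> \<in> A"
    using assms(3) by (auto simp: fin_gen_subalgebra_def is_K_subalgebra_def intro: subringE(3))
  then have "1 \<in> A" by (simp add: type_algebra_def)
  then interpret graded_valued_algebra scale v A Agr
    using assms by (intro graded_valued_algebra.intro valued_algebra.intro
      graded_valued_algebra_axioms.intro)
  \<comment> \<open>For \<open>f = 0\<close> any degree may be obtained here; the first step of the
    assumed run then rules this case out, since it requires a non-zero remainder.\<close>
  from f\<G> obtain \<delta> where \<delta>: "f \<in> Agr \<delta>" by (auto simp: homogeneous_def)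
  have \<G>: "\<G> \<subseteq> nonzero_homogeneous" using f\<G> by (auto simp: nonzero_homogeneous_def)
  show "subduction_terminates scale v Agr \<G> f"
    unfolding subduction_terminates_def
  proof
    assume "\<exists>s :: nat \<Rightarrow> ('b, 'k) subduction_state.
      s 0 = ({}, 0, f) \<and> (\<forall>n. subduction_step scale v Agr \<G> (s n) (s (Suc n)))"
    then obtain s :: "nat \<Rightarrow> ('b, 'k) subduction_state" where s0: "s 0 = ({}, 0, f)"
      and step: "\<And>n. subduction_step scale v Agr \<G> (s n) (s (Suc n))" by blast
    define r where "r n = snd (snd (s n))" for n
    \<comment> \<open>Each remainder of an infinite run has a further step, so the loop condition
      makes it non-zero.\<close>
    have r: "r n \<noteq> 0 \<and> (\<exists>fs h. subduction_choice scale v Agr \<G> (r n) fs h \<and>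
        r (Suc n) = r n - eval_poly (type_algebra scale) id h)" for n
      using step[of n]
      by (cases rule: subduction_step.cases) (auto simp: r_def subduction_loop_condition_def)
    then have nz: "\<And>n. r n \<noteq> 0" by blast
    have next_r: "r (Suc n) \<in> Agr \<delta> \<inter> F_gt v (v (r n))" if "r n \<in> Agr \<delta>" for n
      using r[of n] subduction_step_remainder[OF nz that \<G>] by auto
    have Agr_r: "r n \<in> Agr \<delta>" for n
      by (induction n) (use next_r \<delta> in \<open>auto simp: r_def s0\<close>)
    have "v (r n) < v (r (Suc n))" for n
      using next_r[OF Agr_r] nz by (auto simp: F_gt_def)
    then have "strict_mono (\<lambda>n. v (r n))" by (simp add: strict_mono_Suc_iff)
    then show False
      using no_increasing_values_finite_dimensional[of "Agr \<delta>" r] assms(7) Agr_r nz by blast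
  qed
qed

end
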